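(* Let $\varphi\in A_\infty[0,1)$ be a Musielak–Orlicz function on $[0,1)$ of uniformly lower type $p_\varphi^-$ and uniformly upper type $p_\varphi^+$ with $q(\varphi)<p_\varphi^-\le p_\varphi^+<\infty$. Then there is $C>0$ such that for all $f\in L^\varphi[0,1)\cap L^1[0,1)$, $$\sup_{n\in\mathbb N}\|s_nf\|_{L^\varphi[0,1)}\le C\|f\|_{L^\varphi[0,1)}.$$
   Context: Take $\Omega=[0,1)$ with Lebesgue measure $\mathbb P$, and $\mathcal F_n$ the $\sigma$-algebra generated by the dyadic intervals $[k2^{-n},(k+1)2^{-n})$, $0\le k<2^n$; $\mathbb E_n$ the conditional expectations. A Musielak–Orlicz function is $\varphi:[0,1)\times[0,\infty)\to[0,\infty)$ with $\varphi(x,\cdot)$ nondecreasing, $\varphi(x,0)=0$, $\lim_{t\to\infty}\varphi(x,t)=\infty$, $\varphi(\cdot,t)$ measurable, positive, integrable; $\|g\|_{L^\varphi}:=\inf\{\lambda>0:\int_0^1\varphi(x,|g|/\lambda)dx\le1\}$. Uniformly lower (upper) type $p$: $\varphi(x,st)\le Cs^p\varphi(x,t)$ for $s\in(0,1)$ (resp. $s\ge1$). $\varphi\in A_q[0,1)$ ($q>1$): $\sup_{t>0}\mathbb E_n(\varphi(\cdot,t))[\mathbb E_n(\varphi(\cdot,t)^{-1/(q-1)})]^{q-1}\le K$ a.e. for all $n$; $A_1$: $\sup_t\mathbb E_n(\varphi(\cdot,t))/\varphi(\cdot,t)\le K$; $A_\infty=\bigcup_{q\ge1}A_q$; $q(\varphi)=\inf\{q\ge1:\varphi\in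 A_q\}$. Rademacher functions: $r(x)=1$ on $[0,1/2)$, $-1$ on $[1/2,1)$ (extended 1-periodically), $r_n(x)=r(2^nx)$. Walsh functions: $w_n=\prod_{k\ge0}r_k^{n_k}$ where $n=\sum_kn_k2^k$, $n_k\in\{0,1\}$. $\widehat f(n)=\int_0^1fw_n$, and $s_nf:=\sum_{k=0}^{n-1}\widehat f(k)w_k$. *)

theory Defs
  imports "HOL-Analysis.Analysis"
begin

abbreviation U01 :: "real measure" where
  "U01 \<equiv> lebesgue_on {0..<1}"

definition dyadic_int :: "nat \<Rightarrow> nat \<Rightarrow> real set" where
  "dyadic_int n k = {real k / 2^n ..< (real k + 1) / 2^n}"

text \<open>Average of h over the dyadic interval (n,k); E_n h is this value on that interval.\<close>
definition dyadic_avg :: "nat \<Rightarrow> nat \<Rightarrow> (real \<Rightarrow> real) \<Rightarrow> real" where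
  "dyadic_avg n k h = 2^n * (LINT y:dyadic_int n k|lebesgue. h y)"

definition MO_function :: "(real \<Rightarrow> real \<Rightarrow> real) \<Rightarrow> bool" where
  "MO_function \<phi> \<longleftrightarrow>
     (\<forall>x\<in>{0..<1}. mono_on {0..} (\<phi> x) \<and> \<phi> x 0 = 0 \<and>
                   (\<forall>t\<ge>0. \<phi> x t \<ge> 0) \<and> filterlim (\<phi> x) at_top at_top) \<and>
     (\<forall>t>0. (\<lambda>x. \<phi> x t) \<in> borel_measurable U01 \<and> integrable U01 (\<lambda>x. \<phi> x t)
            \<and> (\<forall>x\<in>{0..<1}. \<phi> x t > 0))"

definition uniformly_lower_type :: "(real \<Rightarrow> real \<Rightarrow> real) \<Rightarrow> real \<Rightarrow> bool" where
  "uniformly_lower_type \<phi> p \<longleftrightarrow>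
     (\<exists>C. \<forall>x\<in>{0..<1}. \<forall>s t. 0 < s \<and> s < 1 \<and> 0 \<le> t \<longrightarrow> \<phi> x (s * t) \<le> C * s powr p * \<phi> x t)"

definition uniformly_upper_type :: "(real \<Rightarrow> real \<Rightarrow> real) \<Rightarrow> real \<Rightarrow> bool" where
  "uniformly_upper_type \<phi> p \<longleftrightarrow>
     (\<exists>C. \<forall>x\<in>{0..<1}. \<forall>s t. 1 \<le> s \<and> 0 \<le> t \<longrightarrow> \<phi> x (s * t) \<le> C * s powr p * \<phi> x t)"

text \<open>Dyadic Muckenhoupt classes. Since E_n g is constant on each dyadic interval of
  level n (of positive measure), the a.e. condition for q > 1 is stated interval-wise;
  finiteness of E_n(\<phi>(.,t)^(-1/(q-1))) is made explicit as integrability.\<close>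
definition A_class :: "real \<Rightarrow> (real \<Rightarrow> real \<Rightarrow> real) \<Rightarrow> bool" where
  "A_class q \<phi> \<longleftrightarrow>
    (if q = 1 then
       (\<exists>K. \<forall>n. \<forall>t>0. AE x in U01.
          dyadic_avg n (nat \<lfloor>2^n * x\<rfloor>) (\<lambda>y. \<phi> y t) \<le> K * \<phi> x t)
     else q > 1 \<and>
       (\<exists>K. \<forall>n. \<forall>k<2^n. \<forall>t>0.
          set_integrable lebesgue (dyadic_int n k) (\<lambda>y. \<phi> y t powr (-1 / (q - 1))) \<and>
          dyadic_avg n k (\<lambda>y. \<phi> y t) *
            (dyadic_avg n k (\<lambda>y. \<phi> y t powr (-1 / (q - 1)))) powr (q - 1) \<le> K))"

definition A_infty :: "(real \<Rightarrow> real \<Rightarrow> real) \<Rightarrow> bool" where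
  "A_infty \<phi> \<longleftrightarrow> (\<exists>q\<ge>1. A_class q \<phi>)"

definition q_index :: "(real \<Rightarrow> real \<Rightarrow> real) \<Rightarrow> real" where
  "q_index \<phi> = Inf {q. q \<ge> 1 \<and> A_class q \<phi>}"

definition modular :: "(real \<Rightarrow> real \<Rightarrow> real) \<Rightarrow> (real \<Rightarrow> real) \<Rightarrow> ennreal" where
  "modular \<phi> g = (\<integral>\<^sup>+ x. ennreal (\<phi> x \<bar>g x\<bar>) \<partial>U01)"

definition in_L_phi :: "(real \<Rightarrow> real \<Rightarrow> real) \<Rightarrow> (real \<Rightarrow> real) \<Rightarrow> bool" where
  "in_L_phi \<phi> g \<longleftrightarrow> g \<in> borel_measurable U01 \<and>
     (\<exists>c>0. modular \<phi> (\<lambda>x. g x / c) \<le> 1)"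

definition L_phi_norm :: "(real \<Rightarrow> real \<Rightarrow> real) \<Rightarrow> (real \<Rightarrow> real) \<Rightarrow> real" where
  "L_phi_norm \<phi> g = Inf {c. c > 0 \<and> modular \<phi> (\<lambda>x. g x / c) \<le> 1}"

definition rademacher0 :: "real \<Rightarrow> real" where
  "rademacher0 x = (if frac x < 1/2 then 1 else -1)"

definition rademacher :: "nat \<Rightarrow> real \<Rightarrow> real" where
  "rademacher n x = rademacher0 (2^n * x)"

definition walsh :: "nat \<Rightarrow> real \<Rightarrow> real" where
  "walsh n x = (\<Prod>k<n. if odd (n div 2^k) then rademacher k x else 1)"

definition walsh_coeff :: "(real \<Rightarrow> real) \<Rightarrow> nat \<Rightarrow> real" where
  "walsh_coeff f n = (\<integral>x. f x * walsh n x \<partial>U01)"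

definition walsh_partial_sum :: "nat \<Rightarrow> (real \<Rightarrow> real) \<Rightarrow> real \<Rightarrow> real" where
  "walsh_partial_sum n f x = (\<Sum>k<n. walsh_coeff f k * walsh k x)"

end

theory Submission
  imports Defs
begin

text \<open>
  Up to the unimodular factor \<open>w\<^sub>n\<close>, the partial sum \<open>s\<^sub>n f\<close> is the martingale transform of
  \<open>g = w\<^sub>n f\<close> whose coefficients are the binary digits of \<open>n\<close>. For the weights \<open>\<phi>(\<cdot>, t)\<close>, with constants
  independent of \<open>t\<close>, a good-\<open>\<lambda>\<close> inequality bounds the level sets of the maximal transform by those
  of the dyadic maximal function: one step of it gains only a factor \<open>1 - c\<close> (all that \<open>A\<^sub>q\<close> gives
  without a reverse Hoelder inequality), but between the levels \<open>t\<close> and \<open>2t\<close> it can be iterated as often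
  as needed to beat the doubling constant of \<open>\<phi>\<close>. Summing over the levels \<open>t = r 2\<^sup>i\<close> absorbs the
  transform, and the weak type \<open>(q, q)\<close> bound of the maximal function, applied to \<open>g\<close> truncated at
  height comparable to \<open>t\<close>, leaves a geometric series that converges because \<open>q < p\<^sup>-\<close>.
\<close>

section \<open>Martingale transforms on the dyadic tree\<close>

text \<open>Since \<open>n < 2 ^ n\<close>, only \<open>n\<close> binary digits occur, so the
  good-lambda argument lives on a finite tree: node \<open>(j, k)\<close> with
  \<open>k < 2 ^ j\<close> is the interval \<open>dyadic_int j k\<close>, its parent has index
  \<open>k div 2\<close>, and a weight enters through its integrals over the leaves of depth
  \<open>N\<close>. The bounds are uniform in \<open>N\<close> and in the number of levels;
  absorbing the transform is legitimate because only finitely many levels are summed. The obstacle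
  is the roughness of \<phi>: measurability in x is given for fixed t only, and t enters without any
  smoothness, so there is no derivative in t for a layer-cake formula. The doubling levels
  \<open>r * 2 ^ i\<close> replace it, at the cost of one doubling constant supplied by the upper
  type. The lower type exponent, being larger than 1, also lets a modular bound be scaled down to 1;
  this turns the modular estimate into one for the norm.\<close>

definition descendants :: "nat \<Rightarrow> nat \<Rightarrow> nat set" where
  "descendants d k = {l. l div 2 ^ d = k}"

lemma descendants_eq: "descendants d k = {k * 2 ^ d..<Suc k * 2 ^ d}"
proof -
  have "l div 2 ^ d = k \<longleftrightarrow> k * 2 ^ d \<le> l \<and> l < Suc k * 2 ^ d" for l :: nat
    by (metis div_nat_eqI dividend_less_times_div less_eq_div_iff_mult_less_eq mult.commute
        mult_Suc_right pos2 zero_less_power le_refl)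
  then show ?thesis
    by (simp only: descendants_def set_eq_iff mem_Collect_eq atLeastLessThan_iff simp_thms)
qed

lemma finite_descendants [simp]: "finite (descendants d k)"
  and card_descendants [simp]: "card (descendants d k) = 2 ^ d"
  by (simp_all add: descendants_eq)

lemma descendants_Suc:
  "descendants (Suc d) k = descendants d (2 * k) \<union> descendants d (Suc (2 * k))"
proof -
  have "l div 2 ^ Suc d = l div 2 ^ d div 2" for l :: nat
    by (metis div_mult2_eq power_Suc2)
  then show ?thesis
    by (auto simp: descendants_def)
qed

lemma descendants_less: "l \<in> descendants (N - j) k \<Longrightarrow> j \<le> N \<Longrightarrow> k < 2 ^ j \<Longrightarrow> l < 2 ^ N"
  by (auto simp: descendants_def div_less_iff_less_mult simp flip: power_add)

lemma div_power_diff: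
  fixes l :: nat
  assumes "i \<le> j" "j \<le> N"
  shows "l div 2 ^ (N - j) div 2 ^ (j - i) = l div 2 ^ (N - i)"
  using assms by (simp add: div_mult2_eq [symmetric] power_add [symmetric])

lemma div_power_less: "j \<le> N \<Longrightarrow> l < 2 ^ N \<Longrightarrow> l div 2 ^ (N - j) < (2::nat) ^ j"
  by (simp add: div_less_iff_less_mult flip: power_add)

text \<open>Leaves of \<open>X\<close> are grouped by the first node on their path from the root
  that satisfies \<open>P\<close>. The subtrees below these stopping nodes are disjoint and fill
  \<open>X\<close>, so an inequality proved in each of them adds up. Counting only the part
  \<open>Z\<close> on the left is what lets a good-lambda step gain a factor.\<close>

lemma sum_stopping:
  fixes W V :: "nat \<Rightarrow> real" and P :: "nat \<Rightarrow> nat \<Rightarrow> bool" and N :: nat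
  defines "X \<equiv> {l. l < 2 ^ N \<and> (\<exists>i\<le>N. P i (l div 2 ^ (N - i)))}"
  assumes Z: "Z \<subseteq> X"
    and le: "\<And>j k. \<lbrakk>j \<le> N; k < 2 ^ j; P j k; \<And>i. i < j \<Longrightarrow> \<not> P i (k div 2 ^ (j - i))\<rbrakk>
      \<Longrightarrow> sum W (Z \<inter> descendants (N - j) k) \<le> sum V (descendants (N - j) k)"
  shows "sum W Z \<le> sum V X"
proof -
  define \<sigma> where "\<sigma> l = (LEAST i. P i (l div 2 ^ (N - i)))" for l
  define f where "f l = (\<sigma> l, l div 2 ^ (N - \<sigma> l))" for l
  have fin: "finite X" "finite Z"
    using Z by (auto simp: X_def intro: finite_subset)
  have \<sigma>: "\<sigma> l \<le> N" "P (\<sigma> l) (l div 2 ^ (N - \<sigma> l))" "\<And>i. i < \<sigma> l \<Longrightarrow> \<not> P i (l div 2 ^ (N - i))"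
    if l: "l \<in> X" for l
  proof -
    obtain i where i: "i \<le> N" "P i (l div 2 ^ (N - i))"
      using l by (auto simp: X_def)
    show "\<sigma> l \<le> N"
      unfolding \<sigma>_def using i Least_le order_trans by metis
    show "P (\<sigma> l) (l div 2 ^ (N - \<sigma> l))"
      unfolding \<sigma>_def by (rule LeastI) (rule i)
    show "\<not> P i (l div 2 ^ (N - i))" if "i < \<sigma> l" for i
      using that not_less_Least unfolding \<sigma>_def by blast
  qed
  \<comment> \<open>Leaves below the stopping node of \<open>m\<close> share with \<open>m\<close>
    all ancestors down to that node, hence stop there too.\<close>
  have fibre: "{l \<in> X. f l = f m} = descendants (N - \<sigma> m) (m div 2 ^ (N - \<sigma> m))"
    if m: "m \<in> X" for m
  proof (intro set_eqI iffI)
    fix l assume "l \<in> {l \<in> X. f l = f m}"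
    then show "l \<in> descendants (N - \<sigma> m) (m div 2 ^ (N - \<sigma> m))"
      by (auto simp: f_def descendants_def)
  next
    fix l assume l: "l \<in> descendants (N - \<sigma> m) (m div 2 ^ (N - \<sigma> m))"
    then have eq: "l div 2 ^ (N - i) = m div 2 ^ (N - i)" if "i \<le> \<sigma> m" for i
      using div_power_diff[OF that \<sigma>(1)[OF m]] by (metis (mono_tags, lifting) descendants_def mem_Collect_eq)
    have "l < 2 ^ N"
      using l \<sigma>(1)[OF m] m by (intro descendants_less[OF l]) (auto simp: X_def intro: div_power_less)
    moreover have "P (\<sigma> m) (l div 2 ^ (N - \<sigma> m))"
      using \<sigma>(2)[OF m] eq by simp
    ultimately have "l \<in> X"
      using \<sigma>(1)[OF m] by (auto simp: X_def)
    moreover have "\<sigma> l = \<sigma> m"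
      unfolding \<sigma>_def[of l]
    proof (rule Least_equality)
      show "\<sigma> m \<le> i" if "P i (l div 2 ^ (N - i))" for i
        using \<sigma>(3)[OF m] eq that by (metis leI less_imp_le)
    qed fact
    ultimately show "l \<in> {l \<in> X. f l = f m}"
      using eq by (simp add: f_def)
  qed
  have "sum W Z = (\<Sum>p\<in>f ` X. \<Sum>l\<in>{l \<in> Z. f l = p}. W l)"
    using Z fin by (intro sum.group[symmetric]) auto
  also have "\<dots> \<le> (\<Sum>p\<in>f ` X. \<Sum>l\<in>{l \<in> X. f l = p}. V l)"
  proof (rule sum_mono, elim imageE)
    fix p m assume p: "p = f m" and m: "m \<in> X"
    have "{l \<in> Z. f l = p} = Z \<inter> descendants (N - \<sigma> m) (m div 2 ^ (N - \<sigma> m))"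
      using Z fibre[OF m] p by blast
    moreover have "sum W (Z \<inter> descendants (N - \<sigma> m) (m div 2 ^ (N - \<sigma> m)))
        \<le> sum V (descendants (N - \<sigma> m) (m div 2 ^ (N - \<sigma> m)))"
    proof (rule le)
      show "m div 2 ^ (N - \<sigma> m) < 2 ^ \<sigma> m"
        using m \<sigma>(1)[OF m] by (auto simp: X_def intro: div_power_less)
      show "\<not> P i (m div 2 ^ (N - \<sigma> m) div 2 ^ (\<sigma> m - i))" if "i < \<sigma> m" for i
        using \<sigma>(3)[OF m that] that \<sigma>(1)[OF m] by (simp add: div_power_diff)
    qed (use \<sigma>[OF m] in auto)
    ultimately show "(\<Sum>l\<in>{l \<in> Z. f l = p}. W l) \<le> (\<Sum>l\<in>{l \<in> X. f l = p}. V l)"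
      using fibre[OF m] p by simp
  qed
  also have "\<dots> = sum V X"
    using fin by (intro sum.group) auto
  finally show ?thesis .
qed

text \<open>A level set of the maximal function of \<open>F\<close> along the paths of the
  tree.\<close>

definition exceedance :: "(nat \<Rightarrow> nat \<Rightarrow> real) \<Rightarrow> nat \<Rightarrow> real \<Rightarrow> nat set" where
  "exceedance F N s = {l. l < 2 ^ N \<and> (\<exists>i\<le>N. s < F i (l div 2 ^ (N - i)))}"

lemma finite_exceedance [simp]: "finite (exceedance F N s)"
  by (simp add: exceedance_def)

text \<open>\<open>a\<close> and \<open>u\<close> model the dyadic averages of a function and of its
  modulus, \<open>T\<close> the transform of \<open>a\<close> with coefficients \<open>e\<close>.
  These relations are all that the good-lambda inequality uses.\<close>

locale dyadic_transform =
  fixes a u T :: "nat \<Rightarrow> nat \<Rightarrow> real" and e :: "nat \<Rightarrow> real"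
  assumes a_split: "k < 2 ^ j \<Longrightarrow> a j k = (a (Suc j) (2 * k) + a (Suc j) (Suc (2 * k))) / 2"
    and u_split: "k < 2 ^ j \<Longrightarrow> u j k = (u (Suc j) (2 * k) + u (Suc j) (Suc (2 * k))) / 2"
    and a_le_u: "k < 2 ^ j \<Longrightarrow> \<bar>a j k\<bar> \<le> u j k"
    and T_0: "T 0 k = 0"
    and T_Suc: "T (Suc j) k = T j (k div 2) + e j * (a (Suc j) k - a j (k div 2))"
    and e_le: "\<bar>e j\<bar> \<le> 1"
begin

abbreviation exceed :: "nat \<Rightarrow> real \<Rightarrow> nat set" where
  "exceed \<equiv> exceedance (\<lambda>i k. \<bar>T i k\<bar>)"

abbreviation maximal_exceed :: "nat \<Rightarrow> real \<Rightarrow> nat set" where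
  "maximal_exceed \<equiv> exceedance u"

text \<open>The Bellman function \<open>s\<^sup>2 + 4A\<^sup>2 - v\<^sup>2\<close> of the current deviation \<open>s\<close> and the current
  average \<open>v\<close> does not increase on average from a node to its children, and it stays nonnegative up
  to the first time the maximal function exceeds \<open>A\<close>, because averages at most double in one step.\<close>

lemma card_deviation_le:
  assumes "0 < m" "0 \<le> A" "j + d = N" "k < 2 ^ j" "u j k \<le> 2 * A"
  shows "real (card {l \<in> descendants d k.
            (\<exists>i. j \<le> i \<and> i \<le> N \<and> m < \<bar>T i (l div 2 ^ (N - i)) - \<tau>\<bar>) \<and>
            (\<forall>i. j \<le> i \<and> i \<le> N \<longrightarrow> u i (l div 2 ^ (N - i)) \<le> A)}) * m\<^sup>2
         \<le> 2 ^ d * ((T j k - \<tau>)\<^sup>2 + 4 * A\<^sup>2 - (a j k)\<^sup>2)"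
  using assms(3-5)
proof (induction d arbitrary: j k)
  define Q where "Q j d k = {l \<in> descendants d k.
            (\<exists>i. j \<le> i \<and> i \<le> N \<and> m < \<bar>T i (l div 2 ^ (N - i)) - \<tau>\<bar>) \<and>
            (\<forall>i. j \<le> i \<and> i \<le> N \<longrightarrow> u i (l div 2 ^ (N - i)) \<le> A)}" for j d k
  have fin [simp]: "finite (Q j d k)" for j d k
    by (simp add: Q_def)
  have a2: "(a j k)\<^sup>2 \<le> 4 * A\<^sup>2" if "k < 2 ^ j" "u j k \<le> 2 * A" for j k
  proof -
    have "\<bar>a j k\<bar> \<le> \<bar>2 * A\<bar>"
      using a_le_u[OF that(1)] that(2) by linarith
    then show ?thesis
      by (simp only: abs_le_square_iff) (simp add: power_mult_distrib)
  qed
  \<comment> \<open>The recursion can end in three ways: the average has exceeded \<open>A\<close>,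
    so that no leaf counts; the deviation has exceeded \<open>m\<close>, so that the Bellman value
    is at least \<open>m\<^sup>2\<close>, enough for all \<open>2 ^ d\<close> leaves; or nothing is
    counted.\<close>
  have triv: "real (card (Q j d k)) * m\<^sup>2 \<le> 2 ^ d * ((T j k - \<tau>)\<^sup>2 + 4 * A\<^sup>2 - (a j k)\<^sup>2)"
    if "j + d = N" "k < 2 ^ j" "u j k \<le> 2 * A" and "A < u j k \<or> m < \<bar>T j k - \<tau>\<bar> \<or> Q j d k = {}" for j d k
  proof -
    have nonneg: "0 \<le> 2 ^ d * ((T j k - \<tau>)\<^sup>2 + 4 * A\<^sup>2 - (a j k)\<^sup>2)"
      using a2[OF that(2,3)] by (intro mult_nonneg_nonneg) (simp, use zero_le_power2[of "T j k - \<tau>"] in linarith)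
    show ?thesis
    proof (cases "Q j d k = {}")
      case True
      then show ?thesis using nonneg by simp
    next
      case False
      then obtain l where "l \<in> Q j d k"
        by auto
      then have "l div 2 ^ d = k" "u j (l div 2 ^ (N - j)) \<le> A"
        using that(1) unfolding Q_def descendants_def by auto
      then have "u j k \<le> A"
        using that(1) by auto
      then have "m < \<bar>T j k - \<tau>\<bar>" using that(4) False by simp
      then have "m\<^sup>2 \<le> (T j k - \<tau>)\<^sup>2"
        using \<open>0 < m\<close> by (simp flip: abs_le_square_iff)
      then have "m\<^sup>2 \<le> (T j k - \<tau>)\<^sup>2 + 4 * A\<^sup>2 - (a j k)\<^sup>2"
        using a2[OF that(2,3)] by linarith
      moreover have "card (Q j d k) \<le> 2 ^ d"
        using card_mono[of "descendants d k" "Q j d k"] by (auto simp: Q_def)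
      then have "real (card (Q j d k)) \<le> 2 ^ d"
        by (metis of_nat_le_iff of_nat_numeral of_nat_power)
      ultimately show ?thesis
        by (intro mult_mono) auto
    qed
  qed
  {
    case 0
    then have "Q j 0 k = {} \<or> m < \<bar>T j k - \<tau>\<bar>"
      unfolding Q_def descendants_def by (auto dest: le_antisym)
    then show ?case
      using triv[of j 0 k] 0 unfolding Q_def by auto
  next
    case (Suc d)
    show ?case
    proof (cases "A < u j k \<or> m < \<bar>T j k - \<tau>\<bar>")
      case True
      then show ?thesis
        using triv[of j "Suc d" k] Suc.prems unfolding Q_def by blast
    next
      case False
      let ?l = "2 * k" and ?r = "Suc (2 * k)"
      let ?B = "\<lambda>j k. (T j k - \<tau>)\<^sup>2 + 4 * A\<^sup>2 - (a j k)\<^sup>2"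
      have lt: "?l < 2 ^ Suc j" "?r < 2 ^ Suc j"
        using Suc.prems(2) by auto
      \<comment> \<open>Here \<open>u j k \<le> A\<close> and \<open>u\<close> is nonnegative, so
        each child is at most twice its parent.\<close>
      have u: "u (Suc j) ?l \<le> 2 * A" "u (Suc j) ?r \<le> 2 * A"
        using u_split[OF Suc.prems(2)] abs_ge_zero[THEN order_trans, OF a_le_u[OF lt(1)]]
          abs_ge_zero[THEN order_trans, OF a_le_u[OF lt(2)]] False by auto
      have IH: "real (card (Q (Suc j) d k')) * m\<^sup>2 \<le> 2 ^ d * ?B (Suc j) k'"
        if "k' = ?l \<or> k' = ?r" for k'
        unfolding Q_def using that lt u Suc.prems by (intro Suc.IH) auto
      have "Q j (Suc d) k \<subseteq> Q (Suc j) d ?l \<union> Q (Suc j) d ?r"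
      proof
        fix l assume l: "l \<in> Q j (Suc d) k"
        then obtain i where i: "j \<le> i" "i \<le> N" "m < \<bar>T i (l div 2 ^ (N - i)) - \<tau>\<bar>"
          by (auto simp: Q_def)
        have "l div 2 ^ (N - j) = k"
          using l Suc.prems(1) by (auto simp: Q_def descendants_def)
        then have "i \<noteq> j"
          using i False by auto
        then have "Suc j \<le> i"
          using i by auto
        then show "l \<in> Q (Suc j) d ?l \<union> Q (Suc j) d ?r"
          using l i by (auto simp: Q_def descendants_Suc)
      qed
      then have "card (Q j (Suc d) k) \<le> card (Q (Suc j) d ?l) + card (Q (Suc j) d ?r)"
        using card_mono[OF finite_UnI[OF fin fin]] card_Un_le order_trans by blast
      then have "real (card (Q j (Suc d) k)) * m\<^sup>2
          \<le> (real (card (Q (Suc j) d ?l)) + real (card (Q (Suc j) d ?r))) * m\<^sup>2"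
        by (intro mult_right_mono) auto
      also have "\<dots> \<le> 2 ^ d * (?B (Suc j) ?l + ?B (Suc j) ?r)"
        using IH[of ?l] IH[of ?r] by (simp add: algebra_simps)
      also have "\<dots> \<le> 2 ^ d * (2 * ?B j k)"
      proof (rule mult_left_mono)
        \<comment> \<open>The squares of the children sum to
          \<open>2 * s\<^sup>2 + 2 * (e j)\<^sup>2 * D\<^sup>2\<close> for the deviations and to
          \<open>2 * (a j k)\<^sup>2 + 2 * D\<^sup>2\<close> for the averages, so the increase of
          the latter pays for that of the former.\<close>
        define D where "D = (a (Suc j) ?l - a (Suc j) ?r) / 2"
        define s where "s = T j k - \<tau>"
        have aD: "a (Suc j) ?l = a j k + D" "a (Suc j) ?r = a j k - D"
          using a_split[OF Suc.prems(2)] by (auto simp: D_def field_simps)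
        have sD: "T (Suc j) ?l - \<tau> = s + e j * D" "T (Suc j) ?r - \<tau> = s - e j * D"
          using T_Suc[of j ?l] T_Suc[of j ?r] unfolding aD s_def by (auto simp: algebra_simps)
        have "(e j)\<^sup>2 \<le> 1"
          using e_le[of j] by (simp add: abs_square_le_1)
        then have "(e j)\<^sup>2 * D\<^sup>2 \<le> 1 * D\<^sup>2"
          by (intro mult_right_mono) auto
        then show "?B (Suc j) ?l + ?B (Suc j) ?r \<le> 2 * ?B j k"
          unfolding aD sD s_def[symmetric] by (simp add: power2_eq_square algebra_simps)
      qed simp
      also have "\<dots> = 2 ^ Suc d * ?B j k"
        by (simp only: power_Suc mult_ac)
      finally show ?thesis
        unfolding Q_def .
    qed
  }
qed

text \<open>At the first node where \<open>\<bar>T\<bar>\<close> exceeds \<open>s\<close>, off the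
  maximal set the last increment is at most \<open>2 * A\<close>, so
  \<open>\<bar>T\<bar> \<le> s + 2 * A\<close> there and reaching \<open>s + 10 * A\<close> takes a
  further deviation of more than \<open>8 * A\<close>. By \<open>card_deviation_le\<close> this
  happens on at most \<open>4 / 64 = 1 / 16\<close> of the leaves below, well within the half that
  the hypothesis on \<open>W\<close> tolerates.\<close>

lemma sum_exceed_step:
  fixes W :: "nat \<Rightarrow> real"
  assumes W: "\<And>l. l < 2 ^ N \<Longrightarrow> 0 \<le> W l"
    and small: "\<And>j k E. \<lbrakk>j \<le> N; k < 2 ^ j; E \<subseteq> descendants (N - j) k; 2 * card E \<le> 2 ^ (N - j)\<rbrakk>
       \<Longrightarrow> sum W E \<le> (1 - c) * sum W (descendants (N - j) k)"
    and s: "0 \<le> s" and A: "0 < A"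
  shows "sum W (exceed N (s + 10 * A)) \<le> (1 - c) * sum W (exceed N s) + sum W (maximal_exceed N A)"
proof -
  define Z where "Z = exceed N (s + 10 * A) - maximal_exceed N A"
  have "sum W Z \<le> sum (\<lambda>l. (1 - c) * W l) (exceed N s)"
    unfolding exceedance_def[of _ N s]
  proof (rule sum_stopping)
    show "Z \<subseteq> {l. l < 2 ^ N \<and> (\<exists>i\<le>N. s < \<bar>T i (l div 2 ^ (N - i))\<bar>)}"
      using A by (force simp: Z_def exceedance_def)
  next
    fix j k
    assume jk: "j \<le> N" "k < (2::nat) ^ j" and P: "s < \<bar>T j k\<bar>"
      and nP: "\<And>i. i < j \<Longrightarrow> \<not> s < \<bar>T i (k div 2 ^ (j - i))\<bar>"
    let ?E = "Z \<inter> descendants (N - j) k"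
    have "2 * card ?E \<le> 2 ^ (N - j)"
    proof (cases "?E = {}")
      case False
      then obtain l0 where l0: "l0 \<in> Z" "l0 div 2 ^ (N - j) = k"
        by (auto simp: descendants_def)
      have uZ: "u i (l div 2 ^ (N - i)) \<le> A" if "l \<in> Z" "i \<le> N" for i l
        using that by (force simp: Z_def exceedance_def)
      \<comment> \<open>\<open>T\<close> vanishes at the root and \<open>s\<close> is nonnegative,
        so the stopping node has a parent.\<close>
      have "j \<noteq> 0"
        using P s T_0 by (metis abs_zero not_less)
      then obtain j' where j': "j = Suc j'"
        using not0_implies_Suc by auto
      have k2: "k div 2 = l0 div 2 ^ (N - j')"
        using l0(2) j' jk div_power_diff[of j' j N l0] by simp
      have uA: "u j k \<le> A" "u j' (k div 2) \<le> A"
        using uZ[OF l0(1), of j] uZ[OF l0(1), of j'] l0(2) k2 j' jk by auto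
      have "k div 2 < 2 ^ j'"
        using jk(2) j' by auto
      then have "\<bar>a j k - a j' (k div 2)\<bar> \<le> 2 * A"
        using uA a_le_u[OF jk(2)] a_le_u[of "k div 2" j'] by linarith
      then have "\<bar>e j' * (a j k - a j' (k div 2))\<bar> \<le> 1 * (2 * A)"
        unfolding abs_mult using e_le[of j'] by (intro mult_mono) auto
      moreover have "\<bar>T j' (k div 2)\<bar> \<le> s"
        using nP[of j'] j' by simp
      ultimately have Tjk: "\<bar>T j k\<bar> \<le> s + 2 * A"
        using T_Suc[of j' k] unfolding j' by linarith
      let ?Q = "{l \<in> descendants (N - j) k.
            (\<exists>i. j \<le> i \<and> i \<le> N \<and> 8 * A < \<bar>T i (l div 2 ^ (N - i)) - T j k\<bar>) \<and>
            (\<forall>i. j \<le> i \<and> i \<le> N \<longrightarrow> u i (l div 2 ^ (N - i)) \<le> A)}"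
      have "?E \<subseteq> ?Q"
      proof
        fix l assume l: "l \<in> ?E"
        then obtain i where i: "i \<le> N" "s + 10 * A < \<bar>T i (l div 2 ^ (N - i))\<bar>"
          by (auto simp: Z_def exceedance_def)
        have "\<not> i < j"
        proof
          assume "i < j"
          then have "l div 2 ^ (N - i) = k div 2 ^ (j - i)"
            using l jk div_power_diff[of i j N l] by (simp add: descendants_def)
          then show False
            using nP[OF \<open>i < j\<close>] i A by simp
        qed
        then show "l \<in> ?Q"
          using l i uZ Tjk by (auto intro!: exI[of _ i])
      qed
      then have "card ?E \<le> card ?Q"
        by (intro card_mono) auto
      then have "real (card ?E) * (8 * A)\<^sup>2 \<le> real (card ?Q) * (8 * A)\<^sup>2"
        by (intro mult_right_mono) auto
      also have "\<dots> \<le> 2 ^ (N - j) * ((T j k - T j k)\<^sup>2 + 4 * A\<^sup>2 - (a j k)\<^sup>2)"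
        using A jk uA by (intro card_deviation_le) auto
      also have "\<dots> \<le> 2 ^ (N - j) * (4 * A\<^sup>2)"
        by (intro mult_left_mono) auto
      finally have "(16 * real (card ?E)) * (4 * A\<^sup>2) \<le> 2 ^ (N - j) * (4 * A\<^sup>2)"
        by (simp add: power_mult_distrib)
      then have "16 * real (card ?E) \<le> 2 ^ (N - j)"
        using A by (subst (asm) mult_le_cancel_right_pos) auto
      then have "real (2 * card ?E) \<le> real (2 ^ (N - j))"
        by simp
      then show ?thesis
        by (simp only: of_nat_le_iff)
    qed simp
    then show "sum W ?E \<le> (\<Sum>l\<in>descendants (N - j) k. (1 - c) * W l)"
      using small[OF jk, of ?E] by (simp add: sum_distrib_left)
  qed
  moreover have "sum W (exceed N (s + 10 * A)) \<le> sum W (Z \<union> maximal_exceed N A)"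
    using W by (intro sum_mono2) (auto simp: Z_def exceedance_def)
  moreover have "sum W (Z \<union> maximal_exceed N A) \<le> sum W Z + sum W (maximal_exceed N A)"
    using W by (subst sum.union_inter[symmetric]) (auto simp: Z_def exceedance_def intro!: sum_nonneg)
  ultimately show ?thesis
    by (simp add: sum_distrib_left)
qed

text \<open>The error terms of the \<open>m\<close> steps form a geometric series bounded by
  \<open>1 / c\<close> whatever \<open>m\<close> is, so the factor \<open>(1 - c) ^ m\<close> can be
  made small at no cost except the rise of the level.\<close>

lemma sum_exceed_iterate:
  fixes W :: "nat \<Rightarrow> real"
  assumes W: "\<And>l. l < 2 ^ N \<Longrightarrow> 0 \<le> W l" and c: "0 < c" "c \<le> 1"
    and small: "\<And>j k E. \<lbrakk>j \<le> N; k < 2 ^ j; E \<subseteq> descendants (N - j) k; 2 * card E \<le> 2 ^ (N - j)\<rbrakk>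
       \<Longrightarrow> sum W E \<le> (1 - c) * sum W (descendants (N - j) k)"
    and s: "0 \<le> s" and A: "0 < A"
  shows "sum W (exceed N (s + real m * (10 * A)))
           \<le> (1 - c) ^ m * sum W (exceed N s) + sum W (maximal_exceed N A) / c"
proof (induction m)
  case 0
  then show ?case
    using c W by (auto simp: exceedance_def intro!: divide_nonneg_pos sum_nonneg)
next
  case (Suc m)
  let ?Y = "sum W (maximal_exceed N A)"
  have "sum W (exceed N (s + real (Suc m) * (10 * A)))
      \<le> (1 - c) * sum W (exceed N (s + real m * (10 * A))) + ?Y"
    using sum_exceed_step[OF W small, where s="s + real m * (10 * A)" and A=A] s A
    by (simp add: algebra_simps)
  also have "\<dots> \<le> (1 - c) * ((1 - c) ^ m * sum W (exceed N s) + ?Y / c) + ?Y"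
    using Suc.IH c by (intro add_right_mono mult_left_mono) auto
  also have "\<dots> = (1 - c) ^ Suc m * sum W (exceed N s) + ?Y / c"
    using c by (simp add: field_simps)
  finally show ?case .
qed

end

section \<open>Dyadic integrals and Walsh functions\<close>

text \<open>\<open>nat\<close> sends negative numbers to 0, whence the condition
  \<open>0 \<le> x\<close> in \<open>mem_dyadic_int_iff\<close> and its consequences.\<close>

definition dyadic_index :: "nat \<Rightarrow> real \<Rightarrow> nat" where
  "dyadic_index n x = nat \<lfloor>2 ^ n * x\<rfloor>"

lemma mem_dyadic_int_iff: "x \<in> dyadic_int n k \<longleftrightarrow> 0 \<le> x \<and> dyadic_index n x = k"
proof -
  have "x \<in> dyadic_int n k \<longleftrightarrow> real k \<le> 2 ^ n * x \<and> 2 ^ n * x < real k + 1"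
    by (simp add: dyadic_int_def field_simps)
  also have "\<dots> \<longleftrightarrow> \<lfloor>2 ^ n * x\<rfloor> = int k"
    by (simp add: floor_eq_iff)
  also have "\<dots> \<longleftrightarrow> 0 \<le> x \<and> dyadic_index n x = k"
  proof (cases "0 \<le> x")
    case True
    then have "0 \<le> \<lfloor>2 ^ n * x\<rfloor>" by simp
    then show ?thesis using True by (auto simp: dyadic_index_def)
  next
    case False
    then have "2 ^ n * x < 0" by (simp add: mult_pos_neg)
    then have "\<lfloor>2 ^ n * x\<rfloor> \<noteq> int k" by linarith
    then show ?thesis using False by blast
  qed
  finally show ?thesis .
qed

lemma dyadic_index_Suc:
  assumes "0 \<le> x"
  shows "dyadic_index (Suc n) x = 2 * dyadic_index n x + (if frac (2 ^ n * x) < 1 / 2 then 0 else 1)"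
proof -
  let ?z = "2 ^ n * x"
  have "\<lfloor>2 * ?z\<rfloor> = 2 * \<lfloor>?z\<rfloor> + (if frac ?z < 1 / 2 then 0 else 1)"
    unfolding frac_def by (auto simp: floor_eq_iff) linarith+
  moreover have "0 \<le> \<lfloor>?z\<rfloor>"
    using assms by simp
  ultimately show ?thesis
    by (simp add: dyadic_index_def mult.assoc nat_add_distrib nat_mult_distrib)
qed

lemma dyadic_index_div2: "0 \<le> x \<Longrightarrow> dyadic_index (Suc n) x div 2 = dyadic_index n x"
  by (simp add: dyadic_index_Suc)

lemma dyadic_index_div:
  assumes "0 \<le> x" "j \<le> N"
  shows "dyadic_index N x div 2 ^ (N - j) = dyadic_index j x"
  using assms(2)
proof (induction N rule: dec_induct)
  case (step N)
  have "dyadic_index (Suc N) x div 2 ^ (Suc N - j) = dyadic_index (Suc N) x div 2 div 2 ^ (N - j)"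
    using step by (simp add: Suc_diff_le div_mult2_eq)
  then show ?case
    using step assms by (simp add: dyadic_index_div2)
qed simp

lemma dyadic_index_less:
  assumes "x \<in> {0..<1}"
  shows "dyadic_index n x < 2 ^ n"
proof -
  have "2 ^ n * x < 2 ^ n"
    using assms by simp
  then have "\<lfloor>2 ^ n * x\<rfloor> < 2 ^ n"
    by (simp add: floor_less_iff)
  then show ?thesis
    using assms by (simp add: dyadic_index_def nat_less_iff)
qed

lemma dyadic_int_subset:
  assumes "k < 2 ^ n"
  shows "dyadic_int n k \<subseteq> {0..<1}"
proof -
  have "real (k + 1) \<le> real (2 ^ n)"
    using assms by (subst of_nat_le_iff) simp
  then have "(real k + 1) / 2 ^ n \<le> 1"
    by (simp add: field_simps)
  moreover have "0 \<le> real k / 2 ^ n"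
    by simp
  ultimately show ?thesis
    unfolding dyadic_int_def ivl_subset by blast
qed

lemma dyadic_int_sets [measurable, simp]: "dyadic_int n k \<in> sets lebesgue"
  by (simp add: dyadic_int_def)

lemma measure_dyadic_int [simp]: "measure lebesgue (dyadic_int n k) = 1 / 2 ^ n"
  by (simp add: dyadic_int_def divide_right_mono field_simps)

lemma dyadic_int_split:
  "dyadic_int n k = dyadic_int (Suc n) (2 * k) \<union> dyadic_int (Suc n) (Suc (2 * k))"
proof (rule set_eqI)
  fix x
  have "p div 2 = k \<longleftrightarrow> p = 2 * k \<or> p = Suc (2 * k)" for p :: nat
    by presburger
  then show "x \<in> dyadic_int n k
      \<longleftrightarrow> x \<in> dyadic_int (Suc n) (2 * k) \<union> dyadic_int (Suc n) (Suc (2 * k))"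
    unfolding mem_dyadic_int_iff Un_iff using dyadic_index_div2[of x n] by metis
qed

lemma dyadic_int_disjoint: "k \<noteq> l \<Longrightarrow> dyadic_int n k \<inter> dyadic_int n l = {}"
  by (auto simp: mem_dyadic_int_iff)

abbreviation dyadic_integral :: "nat \<Rightarrow> nat \<Rightarrow> (real \<Rightarrow> real) \<Rightarrow> real" where
  "dyadic_integral n k F \<equiv> (LINT y:dyadic_int n k|lebesgue. F y)"

lemma set_integrable_U01: "integrable U01 F \<longleftrightarrow> set_integrable lebesgue {0..<1} F"
  for F :: "real \<Rightarrow> real"
  by (simp add: set_integrable_def integrable_restrict_space)

lemma set_integrable_dyadic:
  fixes F :: "real \<Rightarrow> real"
  assumes "integrable U01 F" "k < 2 ^ n"
  shows "set_integrable lebesgue (dyadic_int n k) F"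
  by (rule set_integrable_subset[OF _ dyadic_int_sets dyadic_int_subset[OF assms(2)]])
    (use assms(1) in \<open>simp add: set_integrable_U01\<close>)

lemma dyadic_integral_split:
  assumes "integrable U01 F" "k < 2 ^ n"
  shows "dyadic_integral n k F
    = dyadic_integral (Suc n) (2 * k) F + dyadic_integral (Suc n) (Suc (2 * k)) F"
  unfolding dyadic_int_split[of n k]
  using assms by (intro set_integral_Un dyadic_int_disjoint set_integrable_dyadic) auto

lemma sum_dyadic_integral:
  assumes "integrable U01 F" "k < 2 ^ n"
  shows "(\<Sum>l\<in>descendants d k. dyadic_integral (n + d) l F) = dyadic_integral n k F"
  using assms(2)
proof (induction d arbitrary: n k)
  case 0
  then show ?case by (simp add: descendants_def)
next
  case (Suc d)
  have "descendants d (2 * k) \<inter> descendants d (Suc (2 * k)) = {}"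
    by (auto simp: descendants_def)
  then show ?case
    using Suc.prems Suc.IH[of "2 * k" "Suc n"] Suc.IH[of "Suc (2 * k)" "Suc n"]
    by (simp add: descendants_Suc sum.union_disjoint dyadic_integral_split[OF assms(1) Suc.prems])
qed

lemma dyadic_integral_nonneg:
  assumes "\<And>x. x \<in> {0..<1} \<Longrightarrow> 0 \<le> F x" "k < 2 ^ n"
  shows "0 \<le> dyadic_integral n k F"
  using assms dyadic_int_subset[OF assms(2)] unfolding set_lebesgue_integral_def
  by (intro integral_nonneg_AE always_eventually) (auto simp: indicator_def subset_iff)

lemma integral_U01: "(\<integral>x. F x \<partial>U01) = dyadic_integral 0 0 F" for F :: "real \<Rightarrow> real"
  by (simp add: set_lebesgue_integral_def integral_restrict_space dyadic_int_def)

lemma sum_dyadic_integral_all: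
  assumes "integrable U01 F"
  shows "(\<Sum>l<2 ^ N. dyadic_integral N l F) = (\<integral>x. F x \<partial>U01)"
proof -
  have "descendants N 0 = {..<2 ^ N}"
    by (auto simp: descendants_eq)
  then show ?thesis
    using sum_dyadic_integral[OF assms, of 0 0 N] by (simp add: integral_U01)
qed

section \<open>Walsh functions and the Walsh-Dirichlet kernel\<close>

lemma walsh_eq_prod:
  assumes "n < 2 ^ M"
  shows "walsh n x = (\<Prod>k<M. if odd (n div 2 ^ k) then rademacher k x else 1)"
proof -
  let ?f = "\<lambda>k. if odd (n div 2 ^ k) then rademacher k x else 1"
  \<comment> \<open>Digits of \<open>n\<close> beyond its binary length vanish, so the product may
    run up to \<open>M\<close> instead of \<open>n\<close>.\<close>
  have one: "?f k = 1" if "M \<le> k \<or> n \<le> k" for k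
  proof -
    have "n < 2 ^ k"
      using that
    proof
      assume "M \<le> k"
      then have "(2::nat) ^ M \<le> 2 ^ k" by simp
      then show ?thesis using assms by linarith
    qed (use less_exp[of k] in linarith)
    then show ?thesis by simp
  qed
  have "prod ?f {..<n} = prod ?f {..<max n M}"
    using one by (intro prod.mono_neutral_left) auto
  also have "\<dots> = prod ?f {..<M}"
    using one by (intro prod.mono_neutral_right) auto
  finally show ?thesis
    by (simp add: walsh_def)
qed

lemma odd_add_power_div:
  fixes n :: nat
  assumes "j < N"
  shows "odd ((2 ^ N + n) div 2 ^ j) \<longleftrightarrow> odd (n div 2 ^ j)"
proof -
  obtain d where N: "N = j + Suc d"
    using assms less_iff_Suc_add by auto
  have "(2 ^ N + n) div 2 ^ j = 2 ^ Suc d + n div 2 ^ j"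
    unfolding N power_add by (subst add.commute) simp
  then show ?thesis by simp
qed

lemma walsh_add_power:
  assumes "n < 2 ^ N"
  shows "walsh (2 ^ N + n) x = rademacher N x * walsh n x"
proof -
  have "(2 ^ N + n) div 2 ^ N = Suc 0"
    using assms by simp
  then have "walsh (2 ^ N + n) x
      = (\<Prod>k<N. if odd ((2 ^ N + n) div 2 ^ k) then rademacher k x else 1) * rademacher N x"
    using assms by (subst walsh_eq_prod[of _ "Suc N"]) simp_all
  also have "(\<Prod>k<N. if odd ((2 ^ N + n) div 2 ^ k) then rademacher k x else 1) = walsh n x"
    using assms by (subst walsh_eq_prod[of n N]) (simp_all add: odd_add_power_div)
  finally show ?thesis by simp
qed

lemma rademacher_eq:
  "0 \<le> x \<Longrightarrow> rademacher n x = (if even (dyadic_index (Suc n) x) then 1 else - 1)"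
  by (simp add: rademacher_def rademacher0_def dyadic_index_Suc)

lemma abs_rademacher [simp]: "\<bar>rademacher n x\<bar> = 1"
  by (simp add: rademacher_def rademacher0_def)

lemma abs_walsh [simp]: "\<bar>walsh n x\<bar> = 1"
  unfolding walsh_def abs_prod by (intro prod.neutral) auto

lemma walsh_mult_self [simp]: "walsh n x * walsh n x = 1"
  using abs_walsh[of n x] by (metis abs_mult_self_eq mult_1)

lemma walsh_cong:
  assumes "n < 2 ^ N" "0 \<le> x" "0 \<le> y" "dyadic_index N x = dyadic_index N y"
  shows "walsh n x = walsh n y"
proof -
  have "rademacher k x = rademacher k y" if "k < N" for k
  proof -
    have "dyadic_index (Suc k) x = dyadic_index (Suc k) y"
      using that assms dyadic_index_div[of x "Suc k" N] dyadic_index_div[of y "Suc k" N]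
      by (simp add: Suc_leI)
    then show ?thesis
      using assms by (simp add: rademacher_eq)
  qed
  then show ?thesis
    unfolding walsh_eq_prod[OF assms(1)] by (intro prod.cong) auto
qed

lemma walsh_measurable [measurable]: "walsh n \<in> borel_measurable borel"
  unfolding walsh_def rademacher_def rademacher0_def frac_def by measurable

text \<open>The integral kernel of the conditional expectation of level \<open>j\<close>; see
  \<open>integral_dyadic_kernel\<close>.\<close>

definition dyadic_kernel :: "nat \<Rightarrow> real \<Rightarrow> real \<Rightarrow> real" where
  "dyadic_kernel j x y = (if dyadic_index j x = dyadic_index j y then 2 ^ j else 0)"

text \<open>Passing to level \<open>Suc N\<close> doubles the kernel where \<open>x\<close> and
  \<open>y\<close> lie in the same half of their common interval and kills it otherwise; the product
  of the two signs tells these cases apart.\<close>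

lemma rademacher_dyadic_kernel:
  assumes "0 \<le> x" "0 \<le> y"
  shows "rademacher N x * rademacher N y * dyadic_kernel N x y
    = dyadic_kernel (Suc N) x y - dyadic_kernel N x y"
  proof -
  have *: "p = q \<longleftrightarrow> p div 2 = q div 2 \<and> (even p \<longleftrightarrow> even q)" for p q :: nat
    by presburger
  show ?thesis
    using assms *[of "dyadic_index (Suc N) x" "dyadic_index (Suc N) y"]
    by (auto simp: rademacher_eq dyadic_kernel_def dyadic_index_div2)
qed

lemma sum_lessThan_power_add:
  fixes f :: "nat \<Rightarrow> real"
  shows "(\<Sum>k<2 ^ N + n. f k) = (\<Sum>k<2 ^ N. f k) + (\<Sum>k<n. f (2 ^ N + k))"
  by (induction n) auto

lemma walsh_kernel_power:
  assumes "x \<in> {0..<1}" "y \<in> {0..<1}"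
  shows "(\<Sum>k<2 ^ N. walsh k x * walsh k y) = dyadic_kernel N x y"
proof (induction N)
  case 0
  have "walsh 0 z = 1" for z by (simp add: walsh_def)
  then show ?case
    using dyadic_index_less[OF assms(1), of 0] dyadic_index_less[OF assms(2), of 0]
    by (simp add: dyadic_kernel_def)
next
  case (Suc N)
  have "(\<Sum>k<2 ^ Suc N. walsh k x * walsh k y)
      = (\<Sum>k<2 ^ N. walsh k x * walsh k y) + (\<Sum>k<2 ^ N. walsh (2 ^ N + k) x * walsh (2 ^ N + k) y)"
    using sum_lessThan_power_add[of _ N "2 ^ N"] by (simp add: mult_2)
  also have "(\<Sum>k<2 ^ N. walsh (2 ^ N + k) x * walsh (2 ^ N + k) y)
      = rademacher N x * rademacher N y * (\<Sum>k<2 ^ N. walsh k x * walsh k y)"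
    unfolding sum_distrib_left by (intro sum.cong) (auto simp: walsh_add_power)
  finally show ?case
    using Suc rademacher_dyadic_kernel[of x y N] assms by simp
qed

text \<open>Here the binary digits of \<open>n\<close> become transform coefficients. For
  \<open>n = 2 ^ N + n'\<close> the kernel is \<open>dyadic_kernel N\<close> plus the Rademacher
  product times the kernel of \<open>n'\<close>. After multiplication by the Walsh factors the first
  part becomes the increment at level \<open>N\<close>, because \<open>walsh n'\<close> is constant
  on intervals of that level; in the second the Rademacher product is squared away.\<close>

lemma walsh_kernel:
  assumes "x \<in> {0..<1}" "y \<in> {0..<1}" "n < 2 ^ N"
  shows "walsh n x * walsh n y * (\<Sum>k<n. walsh k x * walsh k y)
    = (\<Sum>j<N. of_bool (odd (n div 2 ^ j)) * (dyadic_kernel (Suc j) x y - dyadic_kernel j x y))"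
  using assms(3)
proof (induction N arbitrary: n)
  case 0
  then show ?case by simp
next
  case (Suc N)
  show ?case
  proof (cases "n < 2 ^ N")
    case True
    then show ?thesis using Suc.IH[OF True] by simp
  next
    case False
    then obtain n' where n: "n = 2 ^ N + n'"
      using le_Suc_ex not_less by blast
    have n': "n' < 2 ^ N"
      using Suc.prems n by simp
    let ?K = "\<lambda>n. \<Sum>k<n. walsh k x * walsh k y"
    let ?r = "rademacher N x * rademacher N y" and ?w = "walsh n' x * walsh n' y"
    have K: "?K n = dyadic_kernel N x y + ?r * ?K n'"
      unfolding n sum_lessThan_power_add walsh_kernel_power[OF assms(1,2)] sum_distrib_left
      using n' by (intro arg_cong2[where f="(+)"] sum.cong) (auto simp: walsh_add_power)
    have r: "?r * ?r = 1"
      using abs_rademacher[of N x] abs_rademacher[of N y] by (auto simp: abs_if split: if_splits)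
    have w: "?w * dyadic_kernel N x y = dyadic_kernel N x y"
    proof (cases "dyadic_index N x = dyadic_index N y")
      case True
      then have "walsh n' x = walsh n' y"
        using n' assms by (intro walsh_cong) auto
      then show ?thesis by simp
    qed (simp add: dyadic_kernel_def)
    have "walsh n x * walsh n y * ?K n = ?r * (?w * dyadic_kernel N x y) + (?r * ?r) * (?w * ?K n')"
      unfolding K unfolding n walsh_add_power[OF n'] by (simp add: algebra_simps)
    also have "\<dots> = (dyadic_kernel (Suc N) x y - dyadic_kernel N x y) + ?w * ?K n'"
      unfolding w r using rademacher_dyadic_kernel[of x y N] assms by simp
    finally show ?thesis
      using Suc.IH[OF n'] n' by (simp add: n odd_add_power_div)
  qed
qed

section \<open>Walsh partial sums as martingale transforms\<close>

primrec martingale_transform :: "(nat \<Rightarrow> real) \<Rightarrow> (nat \<Rightarrow> nat \<Rightarrow> real) \<Rightarrow> nat \<Rightarrow> nat \<Rightarrow> real" where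
  "martingale_transform e a 0 k = 0"
| "martingale_transform e a (Suc j) k
    = martingale_transform e a j (k div 2) + e j * (a (Suc j) k - a j (k div 2))"

lemma martingale_transform_index:
  assumes "0 \<le> x"
  shows "martingale_transform e a N (dyadic_index N x)
    = (\<Sum>j<N. e j * (a (Suc j) (dyadic_index (Suc j) x) - a j (dyadic_index j x)))"
  by (induction N) (use assms in \<open>simp_all add: dyadic_index_div2\<close>)

lemma integral_dyadic_kernel:
  fixes g :: "real \<Rightarrow> real"
  assumes x: "x \<in> {0..<1}"
  shows "(\<integral>y. g y * dyadic_kernel j x y \<partial>U01) = dyadic_avg j (dyadic_index j x) g"
    and "integrable U01 g \<Longrightarrow> integrable U01 (\<lambda>y. g y * dyadic_kernel j x y)"
proof -
  let ?D = "dyadic_int j (dyadic_index j x)"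
  have D: "?D \<subseteq> {0..<1}"
    using dyadic_int_subset dyadic_index_less[OF x] by blast
  have eq: "indicator {0..<1} y *\<^sub>R (g y * dyadic_kernel j x y) = 2 ^ j * (indicator ?D y *\<^sub>R g y)" for y
  proof -
    have "y \<in> ?D \<longleftrightarrow> y \<in> {0..<1} \<and> dyadic_index j x = dyadic_index j y"
      using D by (auto simp: mem_dyadic_int_iff)
    then show ?thesis
      by (auto simp: dyadic_kernel_def indicator_def)
  qed
  show "(\<integral>y. g y * dyadic_kernel j x y \<partial>U01) = dyadic_avg j (dyadic_index j x) g"
    unfolding dyadic_avg_def set_lebesgue_integral_def integral_mult_right_zero[symmetric]
      eq[symmetric] by (rule integral_restrict_space) simp
  assume "integrable U01 g"
  then have "integrable lebesgue (\<lambda>y. indicator ?D y *\<^sub>R g y)"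
    using set_integrable_dyadic[OF _ dyadic_index_less[OF x]] by (simp add: set_integrable_def)
  then show "integrable U01 (\<lambda>y. g y * dyadic_kernel j x y)"
    unfolding set_integrable_U01 set_integrable_def eq by (rule integrable_mult_right)
qed

lemma borel_measurable_U01: "f \<in> borel_measurable borel \<Longrightarrow> f \<in> borel_measurable U01"
  for f :: "real \<Rightarrow> real"
  by (intro measurable_restrict_space1 measurable_completion) simp

lemma integrable_mult_walsh: "integrable U01 f \<Longrightarrow> integrable U01 (\<lambda>y. f y * walsh n y)"
  for f :: "real \<Rightarrow> real"
proof (rule Bochner_Integration.integrable_bound[of _ f])
  assume "integrable U01 f"
  then have [measurable]: "f \<in> borel_measurable U01" by simp
  have [measurable]: "walsh n \<in> borel_measurable U01"
    by (rule borel_measurable_U01) simp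
  show "(\<lambda>y. f y * walsh n y) \<in> borel_measurable U01"
    by measurable
qed (auto simp: abs_mult)

lemma walsh_partial_sum_eq:
  assumes f: "integrable U01 f" and x: "x \<in> {0..<1}"
  shows "walsh_partial_sum n f x = walsh n x *
    martingale_transform (\<lambda>j. of_bool (odd (n div 2 ^ j)))
      (\<lambda>j k. dyadic_avg j k (\<lambda>y. f y * walsh n y)) n (dyadic_index n x)"
proof -
  let ?g = "\<lambda>y. f y * walsh n y" and ?e = "\<lambda>j. of_bool (odd (n div 2 ^ j)) :: real"
  let ?K = "\<lambda>y. \<Sum>k<n. walsh k x * walsh k y"
  have x0: "0 \<le> x" using x by simp
  have g: "integrable U01 ?g"
    by (rule integrable_mult_walsh[OF f])
  have "walsh_partial_sum n f x = (\<Sum>k<n. \<integral>y. f y * walsh k y * walsh k x \<partial>U01)"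
    unfolding walsh_partial_sum_def walsh_coeff_def
    by (intro sum.cong refl integral_mult_left_zero[symmetric])
  also have "\<dots> = (\<integral>y. (\<Sum>k<n. f y * walsh k y * walsh k x) \<partial>U01)"
    by (intro Bochner_Integration.integral_sum[symmetric] integrable_mult_left integrable_mult_walsh f)
  also have "\<dots> = (\<integral>y. walsh n x * (\<Sum>j<n. ?e j * (?g y * dyadic_kernel (Suc j) x y - ?g y * dyadic_kernel j x y)) \<partial>U01)"
  proof (rule Bochner_Integration.integral_cong)
    fix y assume "y \<in> space U01"
    then have y: "y \<in> {0..<1}" by simp
    have "(\<Sum>k<n. f y * walsh k y * walsh k x) = f y * ?K y"
      by (simp add: sum_distrib_left mult_ac)
    \<comment> \<open>Both inserted squares are 1. They produce the product that
      \<open>walsh_kernel\<close> evaluates; one \<open>walsh n x\<close> stays outside and one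
      \<open>walsh n y\<close> joins \<open>f y\<close>.\<close>
    also have "\<dots> = (walsh n x * walsh n x) * (walsh n y * walsh n y) * (f y * ?K y)"
      by simp
    also have "\<dots> = walsh n x * ?g y * (walsh n x * walsh n y * ?K y)"
      by (simp only: mult_ac)
    also have "walsh n x * walsh n y * ?K y
       = (\<Sum>j<n. ?e j * (dyadic_kernel (Suc j) x y - dyadic_kernel j x y))"
      by (rule walsh_kernel[OF x y less_exp])
    finally show "(\<Sum>k<n. f y * walsh k y * walsh k x) = walsh n x *
       (\<Sum>j<n. ?e j * (?g y * dyadic_kernel (Suc j) x y - ?g y * dyadic_kernel j x y))"
      by (simp add: sum_distrib_left algebra_simps)
  qed simp
  also have "\<dots> = walsh n x * (\<Sum>j<n. ?e j * (dyadic_avg (Suc j) (dyadic_index (Suc j) x) ?g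
      - dyadic_avg j (dyadic_index j x) ?g))"
    by (simp add: Bochner_Integration.integral_sum Bochner_Integration.integral_diff
        integral_dyadic_kernel[OF x] g)
  also have "\<dots> = walsh n x * martingale_transform ?e (\<lambda>j k. dyadic_avg j k ?g) n (dyadic_index n x)"
    by (simp add: martingale_transform_index[OF x0])
  finally show ?thesis .
qed

section \<open>Dyadic Muckenhoupt weights\<close>

lemma MO_functionD:
  assumes "MO_function \<phi>" "x \<in> {0..<1}"
  shows MO_mono: "0 \<le> s \<Longrightarrow> s \<le> t \<Longrightarrow> \<phi> x s \<le> \<phi> x t"
    and MO_nonneg: "0 \<le> t \<Longrightarrow> 0 \<le> \<phi> x t"
    and MO_pos: "0 < t \<Longrightarrow> 0 < \<phi> x t"
    and MO_zero: "\<phi> x 0 = 0"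
  using assms by (auto simp: MO_function_def mono_on_def)

lemma MO_integrable: "MO_function \<phi> \<Longrightarrow> 0 < t \<Longrightarrow> integrable U01 (\<lambda>x. \<phi> x t)"
  by (simp add: MO_function_def)

lemma dyadic_integral_pos:
  assumes "set_integrable lebesgue (dyadic_int n k) v" "\<And>x. x \<in> dyadic_int n k \<Longrightarrow> 0 < v x"
  shows "0 < dyadic_integral n k v"
proof -
  have int: "integrable lebesgue (\<lambda>x. indicator (dyadic_int n k) x *\<^sub>R v x)"
    using assms(1) by (simp add: set_integrable_def)
  have nonneg: "AE x in lebesgue. 0 \<le> indicator (dyadic_int n k) x *\<^sub>R v x"
    using assms(2) by (intro always_eventually) (auto simp: indicator_def less_imp_le)
  have "dyadic_integral n k v \<noteq> 0"
  proof
    assume "dyadic_integral n k v = 0"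
    then have "AE x in lebesgue. indicator (dyadic_int n k) x *\<^sub>R v x = 0"
      using integral_nonneg_eq_0_iff_AE[OF int nonneg] by (simp add: set_lebesgue_integral_def)
    then have "AE x in lebesgue. x \<notin> dyadic_int n k"
      by (rule AE_mp) (use assms(2) in \<open>intro always_eventually, force\<close>)
    then have "dyadic_int n k \<in> null_sets lebesgue"
      by (simp add: AE_iff_null_sets)
    then have "measure lebesgue (dyadic_int n k) = 0"
      by (rule measure_eq_0_null_sets)
    then show False by simp
  qed
  moreover have "0 \<le> dyadic_integral n k v"
    unfolding set_lebesgue_integral_def by (rule integral_nonneg_AE[OF nonneg])
  ultimately show ?thesis by simp
qed

text \<open>The A_q condition in the form of a Jensen inequality against the weight
  \<open>\<phi>(., t)\<close>, uniform in \<open>t\<close> and in the interval. Tested with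
  indicators it compares the weights of subsets, tested with truncations it gives the weak type
  bound.\<close>

definition weighted_avg_bound :: "(real \<Rightarrow> real \<Rightarrow> real) \<Rightarrow> real \<Rightarrow> real \<Rightarrow> bool" where
  "weighted_avg_bound \<phi> q K \<longleftrightarrow>
    (\<forall>n k t h. k < 2 ^ n \<and> 0 < t \<and> integrable U01 h \<and> (\<forall>x\<in>{0..<1}. 0 \<le> h x) \<and>
        integrable U01 (\<lambda>x. h x powr q * \<phi> x t) \<longrightarrow>
      dyadic_integral n k (\<lambda>x. \<phi> x t) * dyadic_avg n k h powr q
        \<le> K * dyadic_integral n k (\<lambda>x. h x powr q * \<phi> x t))"

lemma A_class_one_weighted_avg:
  assumes A: "A_class 1 \<phi>"
  shows "\<exists>K. weighted_avg_bound \<phi> 1 K"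
proof -
  obtain K where K: "\<And>n t. 0 < t \<Longrightarrow>
      AE x in U01. dyadic_avg n (nat \<lfloor>2 ^ n * x\<rfloor>) (\<lambda>y. \<phi> y t) \<le> K * \<phi> x t"
    using A by (auto simp: A_class_def)
  show ?thesis
    unfolding weighted_avg_bound_def
  proof (intro exI allI impI, elim conjE)
    fix n k :: nat and t and h :: "real \<Rightarrow> real"
    assume k: "k < 2 ^ n" and t: "0 < (t::real)" and h: "integrable U01 h"
      and nonneg': "\<forall>x\<in>{0..<1}. 0 \<le> h x" and hw: "integrable U01 (\<lambda>x. h x powr 1 * \<phi> x t)"
    have nonneg: "\<And>x. x \<in> {0..<1} \<Longrightarrow> 0 \<le> h x"
      using nonneg' by blast
    let ?D = "dyadic_int n k"
    define a where "a = dyadic_avg n k (\<lambda>y. \<phi> y t)"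
    have D: "?D \<subseteq> {0..<1}" using dyadic_int_subset[OF k] .
    have "0 \<le> dyadic_integral n k h"
      using nonneg k by (rule dyadic_integral_nonneg)
    then have "dyadic_integral n k (\<lambda>x. \<phi> x t) * dyadic_avg n k h powr 1 = a * dyadic_integral n k h"
      by (simp add: a_def dyadic_avg_def)
    also have "\<dots> = (LINT x:?D|lebesgue. a * h x)"
      by simp
    also have "\<dots> \<le> (LINT x:?D|lebesgue. K * (h x powr 1 * \<phi> x t))"
    proof (rule set_integral_mono_AE)
      have "AE x in lebesgue. x \<in> {0..<1} \<longrightarrow>
          dyadic_avg n (nat \<lfloor>2 ^ n * x\<rfloor>) (\<lambda>y. \<phi> y t) \<le> K * \<phi> x t"
        using K[OF t, of n] by (subst (asm) AE_restrict_space_iff) auto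
      then show "AE x\<in>?D in lebesgue. a * h x \<le> K * (h x powr 1 * \<phi> x t)"
      proof (rule AE_mp, intro always_eventually allI impI)
        fix x assume *: "x \<in> {0..<1} \<longrightarrow>
            dyadic_avg n (nat \<lfloor>2 ^ n * x\<rfloor>) (\<lambda>y. \<phi> y t) \<le> K * \<phi> x t" and x: "x \<in> ?D"
        have "nat \<lfloor>2 ^ n * x\<rfloor> = k"
          using x by (simp add: mem_dyadic_int_iff dyadic_index_def)
        then have "a \<le> K * \<phi> x t"
          using * x D by (auto simp: a_def)
        then have "a * h x \<le> K * \<phi> x t * h x"
          using nonneg x D by (intro mult_right_mono) auto
        then show "a * h x \<le> K * (h x powr 1 * \<phi> x t)"
          using nonneg x D by (auto simp: mult_ac)
      qed
    qed (use h hw k in \<open>auto intro!: set_integrable_mult_right set_integrable_dyadic\<close>)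
    also have "\<dots> = K * dyadic_integral n k (\<lambda>x. h x powr 1 * \<phi> x t)"
      by (rule set_integral_mult_right)
    finally show "dyadic_integral n k (\<lambda>x. \<phi> x t) * dyadic_avg n k h powr 1
        \<le> K * dyadic_integral n k (\<lambda>x. h x powr 1 * \<phi> x t)" .
  qed
qed

text \<open>A pointwise replacement for Hoelder's inequality: where \<open>h\<close> exceeds
  \<alpha> times the dual weight, \<open>h powr (1 - q)\<close> is at most
  \<open>\<alpha> powr (1 - q) * w\<close>, and
  \<open>h = h powr q * h powr (1 - q)\<close>.\<close>

lemma threshold_split:
  fixes h w \<alpha> q :: real
  assumes "1 < q" "0 < w" "0 < \<alpha>" "0 \<le> h"
  shows "h \<le> \<alpha> * w powr (-1 / (q - 1)) + \<alpha> powr (1 - q) * (h powr q * w)"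
proof (cases "h \<le> \<alpha> * w powr (-1 / (q - 1))")
  case True
  moreover have "0 \<le> \<alpha> powr (1 - q) * (h powr q * w)"
    using assms by simp
  ultimately show ?thesis by linarith
next
  case False
  let ?v = "w powr (-1 / (q - 1))"
  have pos: "0 < \<alpha> * ?v"
    using assms by simp
  then have "0 < h"
    using False by linarith
  have "h powr (1 - q) \<le> (\<alpha> * ?v) powr (1 - q)"
    using False pos assms by (intro powr_mono2') auto
  also have "\<dots> = \<alpha> powr (1 - q) * w powr (-1 / (q - 1) * (1 - q))"
    using assms by (simp add: powr_mult powr_powr)
  also have "-1 / (q - 1) * (1 - q) = 1"
    using assms by (simp add: field_simps)
  finally have "h powr q * h powr (1 - q) \<le> h powr q * (\<alpha> powr (1 - q) * w)"
    using assms by (intro mult_left_mono) auto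
  moreover have "h powr q * h powr (1 - q) = h"
    using \<open>0 < h\<close> by (simp flip: powr_add)
  ultimately have "h \<le> \<alpha> powr (1 - q) * (h powr q * w)"
    by (simp add: mult_ac)
  then show ?thesis using pos by linarith
qed

text \<open>Integrating \<open>threshold_split\<close> with a suitable \<alpha> gives Hoelder's
  inequality up to the factor \<open>2 powr q\<close>; the A_q product then controls the power of
  the dual weight.\<close>

lemma A_class_gt_one_weighted_avg:
  assumes MO: "MO_function \<phi>" and A: "A_class q \<phi>" and q: "1 < q"
  shows "\<exists>K. weighted_avg_bound \<phi> q K"
proof -
  obtain K where K: "\<And>n k t. k < 2 ^ n \<Longrightarrow> 0 < t \<Longrightarrow>
      set_integrable lebesgue (dyadic_int n k) (\<lambda>y. \<phi> y t powr (-1 / (q - 1))) \<and>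
      dyadic_avg n k (\<lambda>y. \<phi> y t) * (dyadic_avg n k (\<lambda>y. \<phi> y t powr (-1 / (q - 1)))) powr (q - 1) \<le> K"
    using A q by (auto simp: A_class_def)
  show ?thesis
    unfolding weighted_avg_bound_def
  proof (intro exI allI impI, elim conjE)
    fix n k :: nat and t and h :: "real \<Rightarrow> real"
    assume k: "k < 2 ^ n" and t: "0 < (t::real)" and h: "integrable U01 h"
      and nonneg': "\<forall>x\<in>{0..<1}. 0 \<le> h x" and hw: "integrable U01 (\<lambda>x. h x powr q * \<phi> x t)"
    have nonneg: "\<And>x. x \<in> {0..<1} \<Longrightarrow> 0 \<le> h x"
      using nonneg' by blast
    let ?D = "dyadic_int n k"
    let ?v = "\<lambda>y. \<phi> y t powr (-1 / (q - 1))"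
    define W where "W = dyadic_integral n k (\<lambda>x. \<phi> x t)"
    define V where "V = dyadic_integral n k ?v"
    define H where "H = dyadic_integral n k h"
    define G where "G = dyadic_integral n k (\<lambda>x. h x powr q * \<phi> x t)"
    have D: "?D \<subseteq> {0..<1}" using dyadic_int_subset[OF k] .
    have w: "0 < \<phi> x t" if "x \<in> ?D" for x
      using that D t MO_pos[OF MO] by blast
    have v: "set_integrable lebesgue ?D ?v"
      using K[OF k t] by simp
    have "0 < V"
      unfolding V_def using v by (rule dyadic_integral_pos) (use w in \<open>fastforce simp: powr_gt_zero\<close>)
    have "0 \<le> W"
      unfolding W_def using MO_nonneg[OF MO] t k by (intro dyadic_integral_nonneg) auto
    have "0 \<le> H"
      unfolding H_def using nonneg k by (rule dyadic_integral_nonneg)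
    have "0 \<le> G"
      unfolding G_def using MO_nonneg[OF MO] t k by (intro dyadic_integral_nonneg) auto
    have split: "H \<le> \<alpha> * V + \<alpha> powr (1 - q) * G" if "0 < \<alpha>" for \<alpha>
    proof -
      have 1: "set_integrable lebesgue ?D (\<lambda>x. \<alpha> * ?v x)"
        using v by (intro set_integrable_mult_right) auto
      have 2: "set_integrable lebesgue ?D (\<lambda>x. \<alpha> powr (1 - q) * (h x powr q * \<phi> x t))"
        using hw k by (intro set_integrable_mult_right set_integrable_dyadic) auto
      have "H \<le> (LINT x:?D|lebesgue. \<alpha> * ?v x + \<alpha> powr (1 - q) * (h x powr q * \<phi> x t))"
        unfolding H_def using h k w nonneg D that q
        by (intro set_integral_mono set_integrable_dyadic set_integral_add(1)[OF 1 2] threshold_split) auto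
      also have "\<dots> = \<alpha> * V + \<alpha> powr (1 - q) * G"
        unfolding set_integral_add(2)[OF 1 2] V_def G_def by simp
      finally show ?thesis .
    qed
    have main: "H powr q \<le> 2 powr q * V powr (q - 1) * G"
    proof (cases "H = 0")
      case True
      then show ?thesis using \<open>0 \<le> G\<close> by simp
    next
      case False
      then have "0 < H" using \<open>0 \<le> H\<close> by simp
      \<comment> \<open>This \<alpha> makes the first term \<open>H / 2\<close>, which is moved to
        the left.\<close>
      have "H \<le> H / (2 * V) * V + (H / (2 * V)) powr (1 - q) * G"
        using \<open>0 < H\<close> \<open>0 < V\<close> by (intro split) simp
      then have "H \<le> 2 * ((H / (2 * V)) powr (1 - q) * G)"
        using \<open>0 < V\<close> by simp
      also have "(H / (2 * V)) powr (1 - q) = (2 * V) powr (q - 1) / H powr (q - 1)"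
        using \<open>0 < H\<close> \<open>0 < V\<close> by (simp add: powr_divide powr_diff field_simps)
      finally have "H * H powr (q - 1) \<le> 2 * (2 * V) powr (q - 1) * G"
        using \<open>0 < H\<close> by (simp add: field_simps)
      moreover have "H * H powr (q - 1) = H powr q"
        using \<open>0 < H\<close> by (simp add: powr_mult_base)
      moreover have "2 * (2 * V) powr (q - 1) = 2 powr q * V powr (q - 1)"
        using \<open>0 < V\<close> by (simp add: powr_mult powr_diff)
      ultimately show ?thesis by simp
    qed
    let ?P = "2 ^ n :: real"
    have "W * dyadic_avg n k h powr q = W * ?P powr q * H powr q"
      using \<open>0 \<le> H\<close> by (simp add: dyadic_avg_def H_def powr_mult)
    also have "\<dots> \<le> W * ?P powr q * (2 powr q * V powr (q - 1) * G)"
      using main \<open>0 \<le> W\<close> by (intro mult_left_mono) auto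
    also have "\<dots> = (?P * W * (?P * V) powr (q - 1)) * (2 powr q * G)"
      using \<open>0 < V\<close> by (simp add: powr_mult powr_diff)
    also have "\<dots> \<le> K * (2 powr q * G)"
      using K[OF k t] \<open>0 \<le> G\<close> by (intro mult_right_mono) (auto simp: dyadic_avg_def W_def V_def)
    finally show "dyadic_integral n k (\<lambda>x. \<phi> x t) * dyadic_avg n k h powr q
        \<le> (K * 2 powr q) * dyadic_integral n k (\<lambda>x. h x powr q * \<phi> x t)"
      by (simp add: W_def G_def mult_ac)
  qed
qed

section \<open>Two elementary sums over dyadic levels\<close>

lemma sum_geometric_below_one:
  fixes z s :: real
  assumes "0 < z" "0 < s"
  shows "(\<Sum>i<n. if z * 2 ^ i < 1 then (z * 2 ^ i) powr s else 0) \<le> 1 / (1 - 2 powr - s)"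
proof -
  define B where "B = 1 / (1 - 2 powr - s)"
  have lt: "2 powr - s < 1"
    using assms powr_less_mono[of "- s" 0 2] by simp
  have B_aux: "1 / (1 - d) * d + 1 = 1 / (1 - d)" if "d < 1" for d :: real
    using that by (simp add: field_simps)
  from lt have B: "0 < B" "B * 2 powr - s + 1 = B"
    unfolding B_def using B_aux by (simp, blast)
  \<comment> \<open>Strengthened for the induction: \<open>z * 2 ^ n / 2\<close> is the last of the
    \<open>n\<close> bases, capped at 1, and \<open>B\<close> is the fixed point of
    \<open>B * 2 powr - s + 1 = B\<close>.\<close>
  have "(\<Sum>i<n. if z * 2 ^ i < 1 then (z * 2 ^ i) powr s else 0) \<le> B * (min 1 (z * 2 ^ n / 2)) powr s"
  proof (induction n)
    case 0
    then show ?case using assms B by simp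
  next
    case (Suc n)
    let ?y = "z * 2 ^ n"
    have y: "0 < ?y" using assms by simp
    show ?case
    proof (cases "?y < 1")
      case True
      have "B * (min 1 (?y / 2)) powr s + ?y powr s = B * (?y powr s * 2 powr - s) + ?y powr s"
        using True y by (simp add: min_def powr_divide powr_minus field_simps)
      also have "\<dots> = (B * 2 powr - s + 1) * ?y powr s"
        by (simp add: algebra_simps)
      also have "\<dots> = B * (min 1 (z * 2 ^ Suc n / 2)) powr s"
        using B True by (simp add: min_def)
      finally show ?thesis
        using Suc True by simp
    next
      case False
      have "B * (min 1 (?y / 2)) powr s \<le> B * 1"
        using B y assms by (intro mult_left_mono powr_le1) auto
      then show ?thesis
        using Suc False by (simp add: min_def)
    qed
  qed
  also have "\<dots> \<le> B * 1"
    using B assms by (intro mult_left_mono powr_le1) auto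
  finally show ?thesis
    by (simp add: B_def)
qed

text \<open>Twice the recurrence reads \<open>2 * S (Suc i) \<le> S i + 2 * B * Y i\<close>; an
  extra summand \<open>S n\<close> carried on the left closes the induction and is dropped by
  positivity at the end.\<close>

lemma sum_halving_recurrence:
  fixes S Y :: "nat \<Rightarrow> real"
  assumes "\<And>i. S (Suc i) \<le> S i / 2 + B * Y i" "\<And>i. 0 \<le> S i"
  shows "(\<Sum>i<n. S (Suc i)) \<le> S 0 + 2 * B * (\<Sum>i<n. Y i)"
proof -
  have "(\<Sum>i<n. S (Suc i)) + S n \<le> S 0 + 2 * B * (\<Sum>i<n. Y i)"
  proof (induction n)
    case (Suc n)
    then show ?case
      using assms(1)[of n] by (simp add: algebra_simps)
  qed simp
  then show ?thesis
    using assms(2)[of n] by linarith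
qed

section \<open>Integrals over unions of leaves\<close>

lemma dyadic_integral_cong:
  "(\<And>x. x \<in> dyadic_int n k \<Longrightarrow> F x = G x) \<Longrightarrow> dyadic_integral n k F = dyadic_integral n k G"
  by (intro set_lebesgue_integral_cong) auto

lemma dyadic_integral_const [simp]: "dyadic_integral n k (\<lambda>x. c) = c / 2 ^ n"
proof -
  have "bounded (dyadic_int n k)"
    by (rule bounded_subset[OF bounded_closed_interval[of "real k / 2 ^ n" "(real k + 1) / 2 ^ n"]])
      (auto simp: dyadic_int_def)
  then have "dyadic_int n k \<in> lmeasurable"
    by (intro bounded_set_imp_lmeasurable) auto
  then show ?thesis
    by (simp add: set_lebesgue_integral_def fmeasurable_def)
qed

lemma dyadic_index_measurable [measurable]: "dyadic_index n \<in> measurable borel (count_space UNIV)"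
  unfolding dyadic_index_def by measurable

lemma dyadic_index_measurable_U01 [measurable]: "dyadic_index n \<in> measurable U01 (count_space UNIV)"
  by (intro measurable_restrict_space1 measurable_completion) simp

lemma integrable_leaves:
  fixes F :: "real \<Rightarrow> real"
  assumes "integrable U01 F"
  shows "integrable U01 (\<lambda>x. of_bool (dyadic_index N x \<in> E) * F x)"
proof (rule Bochner_Integration.integrable_bound[OF assms])
  have [measurable]: "F \<in> borel_measurable U01"
    using assms by simp
  show "(\<lambda>x. of_bool (dyadic_index N x \<in> E) * F x) \<in> borel_measurable U01"
    by measurable
qed (auto simp: abs_mult)

lemma dyadic_integral_leaves:
  "dyadic_integral N l (\<lambda>x. of_bool (dyadic_index N x \<in> E) * F x)
    = (if l \<in> E then dyadic_integral N l F else 0)"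
proof -
  have "dyadic_integral N l (\<lambda>x. of_bool (dyadic_index N x \<in> E) * F x)
      = dyadic_integral N l (\<lambda>x. if l \<in> E then F x else 0)"
    by (rule dyadic_integral_cong) (auto simp: mem_dyadic_int_iff)
  then show ?thesis by auto
qed

lemma integral_leaves:
  assumes "integrable U01 F" "E \<subseteq> {..<2 ^ N}"
  shows "(\<integral>x. of_bool (dyadic_index N x \<in> E) * F x \<partial>U01) = (\<Sum>l\<in>E. dyadic_integral N l F)"
proof -
  have "(\<integral>x. of_bool (dyadic_index N x \<in> E) * F x \<partial>U01)
      = (\<Sum>l<2 ^ N. if l \<in> E then dyadic_integral N l F else 0)"
    by (subst sum_dyadic_integral_all[symmetric, where N=N])
      (auto intro: integrable_leaves assms simp: dyadic_integral_leaves)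
  also have "\<dots> = (\<Sum>l\<in>E. dyadic_integral N l F)"
    using assms(2) by (simp add: sum.If_cases Int_absorb1)
  finally show ?thesis .
qed

lemma dyadic_transform_dyadic_avg:
  fixes g :: "real \<Rightarrow> real"
  assumes g: "integrable U01 g" and e: "\<And>j. \<bar>e j\<bar> \<le> 1"
  shows "dyadic_transform (\<lambda>j k. dyadic_avg j k g) (\<lambda>j k. dyadic_avg j k (\<lambda>y. \<bar>g y\<bar>))
    (martingale_transform e (\<lambda>j k. dyadic_avg j k g)) e"
proof
  have split: "dyadic_avg j k F
      = (dyadic_avg (Suc j) (2 * k) F + dyadic_avg (Suc j) (Suc (2 * k)) F) / 2"
    if "k < 2 ^ j" "integrable U01 F" for j k F
    using dyadic_integral_split[OF that(2,1)] by (simp add: dyadic_avg_def algebra_simps)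
  show "dyadic_avg j k g = (dyadic_avg (Suc j) (2 * k) g + dyadic_avg (Suc j) (Suc (2 * k)) g) / 2"
    if "k < 2 ^ j" for j k
    using that g by (rule split)
  show "dyadic_avg j k (\<lambda>y. \<bar>g y\<bar>)
      = (dyadic_avg (Suc j) (2 * k) (\<lambda>y. \<bar>g y\<bar>) + dyadic_avg (Suc j) (Suc (2 * k)) (\<lambda>y. \<bar>g y\<bar>)) / 2"
    if "k < 2 ^ j" for j k
    using that by (rule split) (use g in simp)
  show "\<bar>dyadic_avg j k g\<bar> \<le> dyadic_avg j k (\<lambda>y. \<bar>g y\<bar>)" if "k < 2 ^ j" for j k
    using set_integral_norm_bound[OF set_integrable_dyadic[OF g that]]
    by (simp add: dyadic_avg_def abs_mult)
qed (use e in auto)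

text \<open>\<open>p\<close> and \<open>p'\<close> are the lower and upper type exponents,
  \<open>q\<close> an A_q exponent below \<open>p\<close>. Constants at least 1 keep their products
  positive and monotone.\<close>

locale muckenhoupt_orlicz =
  fixes \<phi> :: "real \<Rightarrow> real \<Rightarrow> real" and p p' q C1 C2 K :: real
  assumes MO: "MO_function \<phi>"
    and lower: "\<lbrakk>x \<in> {0..<1}; 0 < s; s < 1; 0 \<le> t\<rbrakk> \<Longrightarrow> \<phi> x (s * t) \<le> C1 * s powr p * \<phi> x t"
    and upper: "\<lbrakk>x \<in> {0..<1}; 1 \<le> s; 0 \<le> t\<rbrakk> \<Longrightarrow> \<phi> x (s * t) \<le> C2 * s powr p' * \<phi> x t"
    and avg_bound: "weighted_avg_bound \<phi> q K"
    and q: "1 \<le> q" "q < p" and C: "1 \<le> C1" "1 \<le> C2" "1 \<le> K"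
begin

lemma weighted_avg:
  "\<lbrakk>k < 2 ^ n; 0 < t; integrable U01 h; \<And>x. x \<in> {0..<1} \<Longrightarrow> 0 \<le> h x;
      integrable U01 (\<lambda>x. h x powr q * \<phi> x t)\<rbrakk>
    \<Longrightarrow> dyadic_integral n k (\<lambda>x. \<phi> x t) * dyadic_avg n k h powr q
        \<le> K * dyadic_integral n k (\<lambda>x. h x powr q * \<phi> x t)"
  using avg_bound unfolding weighted_avg_bound_def by blast

abbreviation leaf_weight :: "nat \<Rightarrow> real \<Rightarrow> nat \<Rightarrow> real" where
  "leaf_weight N t l \<equiv> dyadic_integral N l (\<lambda>x. \<phi> x t)"

lemma leaf_weight_nonneg: "0 < t \<Longrightarrow> l < 2 ^ N \<Longrightarrow> 0 \<le> leaf_weight N t l"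
  using MO_nonneg[OF MO] by (intro dyadic_integral_nonneg) auto

lemma sum_leaf_weight:
  assumes "0 < t" "j \<le> N" "k < 2 ^ j"
  shows "(\<Sum>l\<in>descendants (N - j) k. leaf_weight N t l) = dyadic_integral j k (\<lambda>x. \<phi> x t)"
  using sum_dyadic_integral[OF MO_integrable[OF MO assms(1)] assms(3), of "N - j"] assms(2) by simp

text \<open>\<open>weighted_avg\<close> is tested with the indicator of the complement
  \<open>F\<close> of \<open>E\<close> among the leaves below \<open>(j, k)\<close>. Its average is
  at least \<open>1 / 2\<close>, so \<open>F\<close> carries at least the fraction
  \<open>2 powr - q / K\<close> of the weight.\<close>

lemma small_sets:
  assumes t: "0 < t" and jk: "j \<le> N" "k < 2 ^ j"
    and E: "E \<subseteq> descendants (N - j) k" "2 * card E \<le> 2 ^ (N - j)"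
  shows "sum (leaf_weight N t) E
    \<le> (1 - 2 powr - q / K) * sum (leaf_weight N t) (descendants (N - j) k)"
proof -
  let ?D = "descendants (N - j) k"
  define F where "F = ?D - E"
  define h where "h x = (of_bool (dyadic_index N x \<in> F) * 1 :: real)" for x
  have finE: "finite E"
    using E finite_descendants finite_subset by blast
  have one: "integrable U01 (\<lambda>x. 1 :: real)"
    by (auto simp: set_integrable_U01 set_integrable_def)
  have h: "integrable U01 h"
    unfolding h_def by (rule integrable_leaves[OF one])
  have hq: "(\<lambda>x. h x powr q * \<phi> x t) = (\<lambda>x. of_bool (dyadic_index N x \<in> F) * \<phi> x t)"
    by (auto simp: h_def)
  have w: "integrable U01 (\<lambda>x. of_bool (dyadic_index N x \<in> F) * \<phi> x t)"
    by (rule integrable_leaves[OF MO_integrable[OF MO t]])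
  have DF: "?D \<inter> F = F"
    by (auto simp: F_def)
  have sumF: "(\<Sum>l\<in>?D. if l \<in> F then f l else 0) = sum f F" for f :: "nat \<Rightarrow> real"
    by (simp add: sum.If_cases DF)
  have "dyadic_integral j k h = (\<Sum>l\<in>?D. dyadic_integral N l h)"
    using sum_dyadic_integral[OF h jk(2), of "N - j"] jk(1) by simp
  also have "\<dots> = (\<Sum>l\<in>F. dyadic_integral N l (\<lambda>x. 1))"
    unfolding h_def dyadic_integral_leaves sumF ..
  also have "\<dots> = real (card F) / 2 ^ N"
    by simp
  finally have "dyadic_avg j k h = real (card F) * 2 ^ j / 2 ^ N"
    by (simp add: dyadic_avg_def)
  also have "(2::real) ^ N = 2 ^ (N - j) * 2 ^ j"
    using jk(1) by (simp flip: power_add)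
  finally have avg: "dyadic_avg j k h = real (card F) / 2 ^ (N - j)"
    by simp
  have "real (card F) = 2 ^ (N - j) - real (card E)"
    unfolding F_def using card_Diff_subset[OF finE E(1)] card_mono[OF _ E(1)]
    by (simp add: of_nat_diff)
  moreover have "real (2 * card E) \<le> real (2 ^ (N - j))"
    using E(2) by (simp only: of_nat_le_iff)
  ultimately have "1 / 2 \<le> dyadic_avg j k h"
    unfolding avg by (simp add: field_simps)
  then have "(1 / 2) powr q \<le> dyadic_avg j k h powr q"
    using q by (intro powr_mono2) auto
  then have "sum (leaf_weight N t) ?D * (1 / 2) powr q
      \<le> dyadic_integral j k (\<lambda>x. \<phi> x t) * dyadic_avg j k h powr q"
    unfolding sum_leaf_weight[OF t jk] using leaf_weight_nonneg[OF t jk(2)] by (intro mult_left_mono)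
  also have "\<dots> \<le> K * dyadic_integral j k (\<lambda>x. h x powr q * \<phi> x t)"
  proof (rule weighted_avg[OF jk(2) t h])
    show "0 \<le> h x" for x
      by (simp add: h_def)
  qed (simp add: hq w)
  also have "dyadic_integral j k (\<lambda>x. h x powr q * \<phi> x t) = sum (leaf_weight N t) F"
    unfolding hq using sum_dyadic_integral[OF w jk(2), of "N - j"] jk(1)
    by (simp add: dyadic_integral_leaves sumF)
  also have "\<dots> = sum (leaf_weight N t) ?D - sum (leaf_weight N t) E"
    unfolding F_def using E by (intro sum_diff) auto
  also have "(1 / 2 :: real) powr q = 2 powr - q"
    by (simp add: powr_divide powr_minus_divide)
  finally show ?thesis
    using C(3) by (simp add: field_simps)
qed

text \<open>Values of \<open>\<bar>g\<bar>\<close> up to \<open>s / 2\<close> add at most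
  \<open>s / 2\<close> to an average, so where the average of \<open>\<bar>g\<bar>\<close> exceeds
  \<open>s\<close> that of \<open>h s\<close> is at least \<open>s / 2\<close>, and
  \<open>weighted_avg\<close> applies at the first such nodes. Keeping only the large values is what
  makes the bounds summable over the levels.\<close>

lemma maximal_weak_type:
  fixes g :: "real \<Rightarrow> real"
  defines "h \<equiv> \<lambda>s x. if s / 2 < \<bar>g x\<bar> then \<bar>g x\<bar> else 0"
  assumes g: "integrable U01 g" and t: "0 < t" and s: "0 < s"
    and hw: "integrable U01 (\<lambda>x. h s x powr q * \<phi> x t)"
  shows "sum (leaf_weight N t) (exceedance (\<lambda>j k. dyadic_avg j k (\<lambda>y. \<bar>g y\<bar>)) N s)
    \<le> K * ((s / 2) powr - q * (\<integral>x. h s x powr q * \<phi> x t \<partial>U01))"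
proof -
  let ?u = "\<lambda>j k. dyadic_avg j k (\<lambda>y. \<bar>g y\<bar>)"
  let ?G = "\<lambda>n l. dyadic_integral n l (\<lambda>x. h s x powr q * \<phi> x t)"
  define V where "V l = K * ((s / 2) powr - q * ?G N l)" for l
  have [measurable]: "g \<in> borel_measurable U01" using g by simp
  have h: "integrable U01 (h s)"
    using g by (rule Bochner_Integration.integrable_bound) (auto simp: h_def)
  have V: "0 \<le> V l" if "l < 2 ^ N" for l
    unfolding V_def using C that MO_nonneg[OF MO] t
    by (intro mult_nonneg_nonneg dyadic_integral_nonneg) auto
  have sumV: "sum V L = K * ((s / 2) powr - q * (\<Sum>l\<in>L. ?G N l))" for L
    by (simp add: V_def sum_distrib_left)
  have "sum (leaf_weight N t) (exceedance ?u N s) \<le> sum V (exceedance ?u N s)"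
    unfolding exceedance_def
  proof (rule sum_stopping[OF order_refl])
    fix j k assume jk: "j \<le> N" "k < (2::nat) ^ j" and P: "s < ?u j k"
    let ?Z = "{l. l < 2 ^ N \<and> (\<exists>i\<le>N. s < ?u i (l div 2 ^ (N - i)))}"
    have const: "set_integrable lebesgue (dyadic_int j k) (\<lambda>x. s / 2)"
      by (rule set_integrable_dyadic[OF _ jk(2)]) (auto simp: set_integrable_U01 set_integrable_def)
    have hD: "set_integrable lebesgue (dyadic_int j k) (h s)"
      by (rule set_integrable_dyadic[OF h jk(2)])
    have "dyadic_integral j k (\<lambda>y. \<bar>g y\<bar>) \<le> dyadic_integral j k (\<lambda>x. s / 2 + h s x)"
      using g jk s by (intro set_integral_mono set_integral_add(1)[OF const hD] set_integrable_dyadic)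
        (auto simp: h_def)
    also have "\<dots> = s / 2 / 2 ^ j + dyadic_integral j k (h s)"
      unfolding set_integral_add(2)[OF const hD] by simp
    finally have "?u j k \<le> s / 2 + dyadic_avg j k (h s)"
      by (simp add: dyadic_avg_def field_simps)
    then have "s / 2 \<le> dyadic_avg j k (h s)"
      using P by linarith
    then have "(s / 2) powr q \<le> dyadic_avg j k (h s) powr q"
      using q s by (intro powr_mono2) auto
    then have "dyadic_integral j k (\<lambda>x. \<phi> x t) * (s / 2) powr q
        \<le> dyadic_integral j k (\<lambda>x. \<phi> x t) * dyadic_avg j k (h s) powr q"
      using leaf_weight_nonneg[OF t jk(2)] by (intro mult_left_mono)
    also have "\<dots> \<le> K * ?G j k"
      using jk t h hw by (intro weighted_avg) (auto simp: h_def)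
    finally have "dyadic_integral j k (\<lambda>x. \<phi> x t) \<le> K * ((s / 2) powr - q * ?G j k)"
      using s by (simp add: powr_minus field_simps)
    moreover have "descendants (N - j) k \<subseteq> ?Z"
    proof
      fix l assume l: "l \<in> descendants (N - j) k"
      then have "s < ?u j (l div 2 ^ (N - j))"
        using P unfolding descendants_def by blast
      then show "l \<in> ?Z"
        using descendants_less[OF l jk] jk(1) by blast
    qed
    then have "?Z \<inter> descendants (N - j) k = descendants (N - j) k"
      by blast
    moreover have "(\<Sum>l\<in>descendants (N - j) k. ?G N l) = ?G j k"
      using sum_dyadic_integral[OF hw jk(2), of "N - j"] jk(1) by simp
    ultimately show "sum (leaf_weight N t) (?Z \<inter> descendants (N - j) k)
        \<le> sum V (descendants (N - j) k)"
      by (simp only: sumV sum_leaf_weight[OF t jk])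
  qed
  also have "\<dots> \<le> sum V {..<2 ^ N}"
    using V by (intro sum_mono2) (auto simp: exceedance_def)
  also have "\<dots> = K * ((s / 2) powr - q * (\<integral>x. h s x powr q * \<phi> x t \<partial>U01))"
    by (simp add: sumV sum_dyadic_integral_all[OF hw])
  finally show ?thesis .
qed

text \<open>With \<open>z = \<gamma> * r / (2 * y)\<close> the \<open>i\<close>-th term vanishes
  unless \<open>z * 2 ^ i < 1\<close>. Then the lower type gives the power \<open>p\<close> of
  \<open>z * 2 ^ i\<close>, the upper type gives \<open>(2 / \<gamma>) powr p'\<close>, and the
  normalisation leaves the power \<open>- q\<close>: a geometric series, since
  \<open>q < p\<close>.\<close>

lemma sum_levels_le:
  assumes x: "x \<in> {0..<1}" and y: "0 \<le> y" and \<gamma>: "0 < \<gamma>" "\<gamma> \<le> 1" and r: "0 < r"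
  shows "(\<Sum>i<n. (\<gamma> * (r * 2 ^ i) / 2) powr - q *
            ((if \<gamma> * (r * 2 ^ i) / 2 < y then y else 0) powr q * \<phi> x (r * 2 ^ i)))
         \<le> C1 * C2 * (2 / \<gamma>) powr p' * (1 / (1 - 2 powr - (p - q))) * \<phi> x y"
proof (cases "y = 0")
  case True
  have "\<not> \<gamma> * (r * 2 ^ i) / 2 < 0" for i
    using \<gamma> r by (simp add: not_less)
  then show ?thesis
    using True MO_zero[OF MO x] by simp
next
  case False
  then have y: "0 < y" using y by simp
  define z where "z = \<gamma> * r / (2 * y)"
  define B where "B = C1 * C2 * (2 / \<gamma>) powr p' * \<phi> x y"
  have z: "0 < z" using \<gamma> r y by (simp add: z_def)
  have B: "0 \<le> B"
    unfolding B_def using C MO_nonneg[OF MO x] y by (intro mult_nonneg_nonneg) auto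
  have "(\<Sum>i<n. (\<gamma> * (r * 2 ^ i) / 2) powr - q *
            ((if \<gamma> * (r * 2 ^ i) / 2 < y then y else 0) powr q * \<phi> x (r * 2 ^ i)))
      \<le> (\<Sum>i<n. B * (if z * 2 ^ i < 1 then (z * 2 ^ i) powr (p - q) else 0))"
  proof (rule sum_mono)
    fix i
    let ?z = "z * 2 ^ i"
    have z0: "0 < ?z" using z by simp
    have eq: "\<gamma> * (r * 2 ^ i) / 2 = ?z * y" "r * 2 ^ i = ?z * (2 / \<gamma> * y)"
      using y \<gamma> by (simp_all add: z_def field_simps)
    have iff: "?z * y < y \<longleftrightarrow> ?z < 1"
      using y by simp
    show "(\<gamma> * (r * 2 ^ i) / 2) powr - q *
            ((if \<gamma> * (r * 2 ^ i) / 2 < y then y else 0) powr q * \<phi> x (r * 2 ^ i))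
        \<le> B * (if ?z < 1 then ?z powr (p - q) else 0)"
    proof (cases "?z < 1")
      case True
      have "\<phi> x (?z * (2 / \<gamma> * y)) \<le> C1 * ?z powr p * \<phi> x (2 / \<gamma> * y)"
        using z0 True x y \<gamma> by (intro lower) auto
      also have "\<dots> \<le> C1 * ?z powr p * (C2 * (2 / \<gamma>) powr p' * \<phi> x y)"
        using x y \<gamma> C by (intro mult_left_mono upper) (auto simp: field_simps)
      finally have le: "\<phi> x (r * 2 ^ i) \<le> ?z powr p * B"
        unfolding eq(2) by (simp add: B_def mult_ac)
      have "(?z * y) powr - q * (y powr q * \<phi> x (r * 2 ^ i)) = ?z powr - q * \<phi> x (r * 2 ^ i)"
        using z0 y by (simp add: powr_mult powr_minus field_simps)
      also have "\<dots> \<le> ?z powr - q * (?z powr p * B)"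
        using le by (intro mult_left_mono) auto
      also have "\<dots> = B * ?z powr (p - q)"
        using z0 by (simp add: powr_diff powr_minus field_simps)
      finally show ?thesis
        unfolding eq(1) iff using True by simp
    next
      case False
      then show ?thesis
        unfolding eq(1) iff by simp
    qed
  qed
  also have "\<dots> = B * (\<Sum>i<n. if z * 2 ^ i < 1 then (z * 2 ^ i) powr (p - q) else 0)"
    by (simp add: sum_distrib_left)
  also have "\<dots> \<le> B * (1 / (1 - 2 powr - (p - q)))"
    using B z q by (intro mult_left_mono sum_geometric_below_one) auto
  finally show ?thesis
    by (simp add: B_def mult_ac)
qed

section \<open>From level sets to the modular\<close>

lemma doubling: "x \<in> {0..<1} \<Longrightarrow> 0 \<le> t \<Longrightarrow> \<phi> x (2 * t) \<le> C2 * 2 powr p' * \<phi> x t"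
  by (rule upper) auto

text \<open>A discrete layer-cake bound: for \<open>y > 2 * r\<close> the largest level below
  \<open>y\<close> controls \<open>\<phi> x y\<close> by doubling, and the other terms are
  nonnegative; smaller \<open>y\<close> are covered by \<open>\<phi> x (2 * r)\<close>.\<close>

lemma le_sum_levels:
  assumes x: "x \<in> {0..<1}" and y: "0 \<le> y" "y \<le> r * 2 ^ Suc n" and r: "0 < r"
  shows "\<phi> x y \<le> \<phi> x (2 * r)
    + C2 * 2 powr p' * (\<Sum>i<n. of_bool (r * 2 ^ Suc i < y) * \<phi> x (r * 2 ^ Suc i))"
  using y(2)
proof (induction n)
  case 0
  then show ?case
    using MO_mono[OF MO x y(1)] by (simp add: mult.commute)
next
  case (Suc n)
  let ?D = "C2 * 2 powr p'"
  let ?S = "\<Sum>i<n. of_bool (r * 2 ^ Suc i < y) * \<phi> x (r * 2 ^ Suc i)"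
  have pos: "0 \<le> \<phi> x t" if "0 < t" for t
    using MO_nonneg[OF MO x] that by simp
  have D: "0 \<le> ?D" using C by simp
  show ?case
  proof (cases "y \<le> r * 2 ^ Suc n")
    case True
    then show ?thesis
      using Suc.IH by simp
  next
    case False
    have "\<phi> x y \<le> \<phi> x (2 * (r * 2 ^ Suc n))"
      using Suc.prems y(1) by (intro MO_mono[OF MO x]) auto
    also have "\<dots> \<le> ?D * \<phi> x (r * 2 ^ Suc n)"
      using x r by (intro doubling) auto
    also have "\<dots> \<le> \<phi> x (2 * r) + ?D * (?S + \<phi> x (r * 2 ^ Suc n))"
      using D pos r by (auto simp: distrib_left intro!: add_nonneg_nonneg mult_nonneg_nonneg sum_nonneg)
    finally show ?thesis
      using False by simp
  qed
qed

text \<open>Integrates \<open>sum_levels_le\<close> with \<open>y = \<bar>g x\<bar>\<close>. The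
  integrability that \<open>maximal_weak_type\<close> requires comes out of the modular bound by the
  same domination.\<close>

lemma sum_level_integrals_le:
  fixes g :: "real \<Rightarrow> real"
  defines "h \<equiv> \<lambda>s x. if s / 2 < \<bar>g x\<bar> then \<bar>g x\<bar> else 0"
  assumes g: "integrable U01 g" and mod: "modular \<phi> g \<le> 1"
    and \<gamma>: "0 < \<gamma>" "\<gamma> \<le> 1" and r: "0 < r"
  shows "integrable U01 (\<lambda>x. h (\<gamma> * (r * 2 ^ i)) x powr q * \<phi> x (r * 2 ^ i))"
    and "(\<Sum>i<n. (\<gamma> * (r * 2 ^ i) / 2) powr - q *
            (\<integral>x. h (\<gamma> * (r * 2 ^ i)) x powr q * \<phi> x (r * 2 ^ i) \<partial>U01))
       \<le> C1 * C2 * (2 / \<gamma>) powr p' * (1 / (1 - 2 powr - (p - q)))"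
proof -
  define B where "B = C1 * C2 * (2 / \<gamma>) powr p' * (1 / (1 - 2 powr - (p - q)))"
  define F where "F i x = (\<gamma> * (r * 2 ^ i) / 2) powr - q *
      (h (\<gamma> * (r * 2 ^ i)) x powr q * \<phi> x (r * 2 ^ i))" for i x
  have "2 powr - (p - q) < 1"
    using q powr_less_mono[of "- (p - q)" 0 2] by simp
  then have B: "0 < B"
    unfolding B_def using C \<gamma> by (intro mult_pos_pos) auto
  have [measurable]: "g \<in> borel_measurable U01" using g by simp
  have [measurable]: "(\<lambda>x. \<phi> x (r * 2 ^ i)) \<in> borel_measurable U01" for i
    using borel_measurable_integrable[OF MO_integrable[OF MO]] r by simp
  have Fm [measurable]: "F i \<in> borel_measurable U01" for i
    unfolding F_def h_def by measurable
  have Fn: "0 \<le> F i x" if "x \<in> {0..<1}" for i x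
    unfolding F_def using MO_nonneg[OF MO that] r by simp
  have le: "(\<Sum>i<n. F i x) \<le> B * \<phi> x \<bar>g x\<bar>" if "x \<in> {0..<1}" for x n
    unfolding F_def h_def B_def using that \<gamma> r by (intro sum_levels_le) auto
  \<comment> \<open>The constant is moved to the measurable side, since \<open>\<phi> x \<bar>g x\<bar>\<close> need not be measurable.\<close>
  have nn: "(\<integral>\<^sup>+x. ennreal (\<Sum>i<n. F i x) \<partial>U01) \<le> ennreal B" for n
  proof -
    have "(\<integral>\<^sup>+x. ennreal (\<Sum>i<n. F i x) \<partial>U01)
        = (\<integral>\<^sup>+x. ennreal B * ennreal ((\<Sum>i<n. F i x) / B) \<partial>U01)"
      using B Fn by (intro nn_integral_cong) (simp add: ennreal_mult[symmetric] sum_nonneg)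
    also have "\<dots> = ennreal B * (\<integral>\<^sup>+x. ennreal ((\<Sum>i<n. F i x) / B) \<partial>U01)"
      by (rule nn_integral_cmult) measurable
    also have "\<dots> \<le> ennreal B * modular \<phi> g"
      unfolding modular_def using le B
      by (intro mult_left_mono nn_integral_mono ennreal_leI) (auto simp: field_simps)
    also have "\<dots> \<le> ennreal B * 1"
      using mod by (intro mult_left_mono) auto
    finally show ?thesis by simp
  qed
  have sum_int: "integrable U01 (\<lambda>x. \<Sum>i<n. F i x)" for n
  proof (rule integrableI_nonneg)
    show "AE x in U01. 0 \<le> (\<Sum>i<n. F i x)"
      using Fn by (intro AE_I2 sum_nonneg) auto
    show "(\<integral>\<^sup>+x. ennreal (\<Sum>i<n. F i x) \<partial>U01) < \<infinity>"
      using nn[of n] by (simp add: le_less_trans)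
  qed measurable
  have Fi: "integrable U01 (F i)" for i
  proof (rule Bochner_Integration.integrable_bound[OF sum_int[of "Suc i"] Fm], intro AE_I2)
    fix x assume "x \<in> space U01"
    then have x: "x \<in> {0..<1}" by simp
    show "norm (F i x) \<le> norm (\<Sum>i<Suc i. F i x)"
      using Fn[OF x] sum_nonneg[of "{..<i}" "\<lambda>i. F i x"] by simp
  qed
  have c: "(\<gamma> * (r * 2 ^ i) / 2) powr - q \<noteq> 0" for i :: nat
    using \<gamma> r by simp
  show "integrable U01 (\<lambda>x. h (\<gamma> * (r * 2 ^ i)) x powr q * \<phi> x (r * 2 ^ i))"
    using Fi[of i] c[of i] unfolding F_def integrable_mult_left_iff by blast
  have "(\<Sum>i<n. (\<gamma> * (r * 2 ^ i) / 2) powr - q *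
            (\<integral>x. h (\<gamma> * (r * 2 ^ i)) x powr q * \<phi> x (r * 2 ^ i) \<partial>U01))
      = (\<Sum>i<n. \<integral>x. F i x \<partial>U01)"
    by (simp add: F_def)
  also have "\<dots> = (\<integral>x. (\<Sum>i<n. F i x) \<partial>U01)"
    using Fi by (simp add: Bochner_Integration.integral_sum)
  also have "\<dots> \<le> B"
  proof -
    have "ennreal (\<integral>x. (\<Sum>i<n. F i x) \<partial>U01) = (\<integral>\<^sup>+x. ennreal (\<Sum>i<n. F i x) \<partial>U01)"
      using Fn by (intro nn_integral_eq_integral[symmetric] sum_int AE_I2 sum_nonneg) auto
    then have "ennreal (\<integral>x. (\<Sum>i<n. F i x) \<partial>U01) \<le> ennreal B"
      using nn[of n] by (simp only:)
    then show ?thesis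
      by (rule ennreal_le_iff[THEN iffD1, OF less_imp_le[OF B]])
  qed
  finally show "(\<Sum>i<n. (\<gamma> * (r * 2 ^ i) / 2) powr - q *
            (\<integral>x. h (\<gamma> * (r * 2 ^ i)) x powr q * \<phi> x (r * 2 ^ i) \<partial>U01))
       \<le> C1 * C2 * (2 / \<gamma>) powr p' * (1 / (1 - 2 powr - (p - q)))"
    by (simp add: B_def)
qed

lemma leaf_weight_doubling:
  assumes "0 < t" "l < 2 ^ N"
  shows "leaf_weight N (2 * t) l \<le> C2 * 2 powr p' * leaf_weight N t l"
proof -
  have "leaf_weight N (2 * t) l \<le> dyadic_integral N l (\<lambda>x. C2 * 2 powr p' * \<phi> x t)"
  proof (rule set_integral_mono)
    show "\<phi> x (2 * t) \<le> C2 * 2 powr p' * \<phi> x t" if "x \<in> dyadic_int N l" for x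
      using that dyadic_int_subset[OF assms(2)] assms(1) by (intro doubling) auto
  qed (use assms in \<open>auto intro!: set_integrable_mult_right set_integrable_dyadic MO_integrable MO\<close>)
  then show ?thesis by simp
qed

text \<open>Since \<open>10 * m * \<gamma> = 1\<close>, the levels \<open>t\<close> and
  \<open>2 * t\<close> are \<open>m\<close> good-lambda steps of size
  \<open>10 * \<gamma> * t\<close> apart. Moving the weight from \<open>t\<close> to
  \<open>2 * t\<close> costs the doubling constant, and the choice of \<open>m\<close> leaves the
  factor \<open>1 / 2\<close> of \<open>sum_halving_recurrence\<close>.\<close>

lemma sum_transform_levels_le:
  fixes g :: "real \<Rightarrow> real" and e :: "nat \<Rightarrow> real"
  defines "T \<equiv> martingale_transform e (\<lambda>j k. dyadic_avg j k g)"
  assumes g: "integrable U01 g" and e: "\<And>j. \<bar>e j\<bar> \<le> 1" and mod: "modular \<phi> g \<le> 1"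
    and c: "c = 2 powr - q / K" and m: "0 < m" "C2 * 2 powr p' * (1 - c) ^ m \<le> 1 / 2"
    and r: "0 < r" and \<gamma>: "\<gamma> = 1 / (10 * real m)"
  shows "(\<Sum>i<n. sum (leaf_weight N (r * 2 ^ Suc i)) (exceedance (\<lambda>j k. \<bar>T j k\<bar>) N (r * 2 ^ Suc i)))
    \<le> (\<integral>x. \<phi> x r \<partial>U01) + 2 * (C2 * 2 powr p' / c) *
        (K * (C1 * C2 * (2 / \<gamma>) powr p' * (1 / (1 - 2 powr - (p - q)))))"
proof -
  define u where "u j k = dyadic_avg j k (\<lambda>y. \<bar>g y\<bar>)" for j k
  interpret dyadic_transform "\<lambda>j k. dyadic_avg j k g" u T e
    unfolding u_def T_def by (rule dyadic_transform_dyadic_avg[OF g e])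
  let ?D = "C2 * 2 powr p'"
  define S where "S i = sum (leaf_weight N (r * 2 ^ i)) (exceed N (r * 2 ^ i))" for i
  define Y where "Y i = sum (leaf_weight N (r * 2 ^ i)) (maximal_exceed N (\<gamma> * (r * 2 ^ i)))" for i
  have t: "0 < r * 2 ^ i" for i :: nat using r by simp
  have \<gamma>01: "0 < \<gamma>" "\<gamma> \<le> 1" using m(1) by (auto simp: \<gamma> divide_le_eq_1)
  have D: "0 \<le> ?D" using C by simp
  have "2 powr - q \<le> 1"
    using q powr_mono[of "- q" 0 2] by simp
  then have c01: "0 < c" "c \<le> 1"
    unfolding c using C by (auto simp: field_simps)
  have S_nonneg: "0 \<le> S i" for i
    unfolding S_def using leaf_weight_nonneg[OF t] by (intro sum_nonneg) (auto simp: exceedance_def)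
  have S_Suc: "S (Suc i) \<le> S i / 2 + ?D / c * Y i" for i
  proof -
    let ?t = "r * 2 ^ i"
    have iterate: "sum (leaf_weight N ?t) (exceed N (?t + real m * (10 * (\<gamma> * ?t))))
        \<le> (1 - c) ^ m * S i + Y i / c"
      unfolding S_def Y_def
    proof (rule sum_exceed_iterate)
      show "sum (leaf_weight N ?t) E \<le> (1 - c) * sum (leaf_weight N ?t) (descendants (N - j) k)"
        if "j \<le> N" "k < 2 ^ j" "E \<subseteq> descendants (N - j) k" "2 * card E \<le> 2 ^ (N - j)" for j k E
        using small_sets[OF t that] by (simp add: c)
    qed (use t[of i] c01 \<gamma>01 leaf_weight_nonneg in \<open>auto intro: less_imp_le\<close>)
    have "S (Suc i) = sum (leaf_weight N (2 * ?t)) (exceed N (2 * ?t))"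
      by (simp add: S_def mult_ac)
    also have "\<dots> \<le> (\<Sum>l\<in>exceed N (2 * ?t). ?D * leaf_weight N ?t l)"
      using t by (intro sum_mono leaf_weight_doubling) (auto simp: exceedance_def)
    also have "\<dots> = ?D * sum (leaf_weight N ?t) (exceed N (2 * ?t))"
      by (simp add: sum_distrib_left)
    also have "2 * ?t = ?t + real m * (10 * (\<gamma> * ?t))"
      using m \<gamma> by simp
    also have "?D * sum (leaf_weight N ?t) (exceed N \<dots>) \<le> ?D * ((1 - c) ^ m * S i + Y i / c)"
      by (intro mult_left_mono iterate D)
    also have "\<dots> = (?D * (1 - c) ^ m) * S i + ?D / c * Y i"
      by (simp add: algebra_simps)
    also have "\<dots> \<le> 1 / 2 * S i + ?D / c * Y i"
      using m S_nonneg by (intro add_right_mono mult_right_mono)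
    finally show ?thesis by simp
  qed
  let ?h = "\<lambda>i x. if \<gamma> * (r * 2 ^ i) / 2 < \<bar>g x\<bar> then \<bar>g x\<bar> else 0"
  have "(\<Sum>i<n. Y i) \<le> (\<Sum>i<n. K * ((\<gamma> * (r * 2 ^ i) / 2) powr - q *
      (\<integral>x. ?h i x powr q * \<phi> x (r * 2 ^ i) \<partial>U01)))"
  proof (rule sum_mono)
    fix i
    show "Y i \<le> K * ((\<gamma> * (r * 2 ^ i) / 2) powr - q * (\<integral>x. ?h i x powr q * \<phi> x (r * 2 ^ i) \<partial>U01))"
      unfolding Y_def u_def
      by (rule maximal_weak_type[OF g t _ sum_level_integrals_le(1)[OF g mod \<gamma>01 r]])
        (use \<gamma>01 r in simp)
  qed
  also have "\<dots> = K * (\<Sum>i<n. (\<gamma> * (r * 2 ^ i) / 2) powr - q *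
      (\<integral>x. ?h i x powr q * \<phi> x (r * 2 ^ i) \<partial>U01))"
    by (simp add: sum_distrib_left)
  also have "\<dots> \<le> K * (C1 * C2 * (2 / \<gamma>) powr p' * (1 / (1 - 2 powr - (p - q))))"
    using C by (intro mult_left_mono sum_level_integrals_le(2)[OF g mod \<gamma>01 r]) auto
  finally have Y: "(\<Sum>i<n. Y i) \<le> K * (C1 * C2 * (2 / \<gamma>) powr p' * (1 / (1 - 2 powr - (p - q))))" .
  have "S 0 \<le> sum (leaf_weight N r) {..<2 ^ N}"
    unfolding S_def power_0 mult_1_right using leaf_weight_nonneg[OF r]
    by (intro sum_mono2) (auto simp: exceedance_def)
  then have S0: "S 0 \<le> (\<integral>x. \<phi> x r \<partial>U01)"
    using sum_dyadic_integral_all[OF MO_integrable[OF MO r]] by simp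
  have "(\<Sum>i<n. S (Suc i)) \<le> S 0 + 2 * (?D / c) * (\<Sum>i<n. Y i)"
    by (rule sum_halving_recurrence) (use S_Suc S_nonneg in auto)
  also have "\<dots> \<le> (\<integral>x. \<phi> x r \<partial>U01) + 2 * (?D / c) *
        (K * (C1 * C2 * (2 / \<gamma>) powr p' * (1 / (1 - 2 powr - (p - q)))))"
    using S0 Y D c01 by (intro add_mono mult_left_mono) auto
  finally show ?thesis
    by (simp only: S_def)
qed

text \<open>As \<open>p > 1\<close>, the lower type gives
  \<open>\<phi> x s \<le> C1 * s * \<phi> x 1\<close> for \<open>0 < s < 1\<close>. Level
  \<open>r\<close> starts the recurrence, and \<open>2 * r\<close> is the remainder in
  \<open>le_sum_levels\<close>.\<close>

lemma integral_small:
  obtains r where "0 < r" "(\<integral>x. \<phi> x r \<partial>U01) \<le> 1" "(\<integral>x. \<phi> x (2 * r) \<partial>U01) \<le> 1"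
proof -
  define I where "I = (\<integral>x. \<phi> x 1 \<partial>U01)"
  \<comment> \<open>Chosen so that \<open>C1 * (2 * r) * (I + 1) = 1 / 2\<close>; the summand 1
    ensures \<open>2 * r < 1\<close>, as the lower type demands.\<close>
  define r where "r = 1 / (4 * (C1 * (I + 1)))"
  have I: "0 \<le> I"
    unfolding I_def using MO_nonneg[OF MO] by (intro integral_nonneg_AE AE_I2) auto
  have M: "1 \<le> C1 * (I + 1)"
    using C I mult_mono[of 1 C1 1 "I + 1"] by simp
  then have r: "0 < r" "2 * r < 1"
    by (auto simp: r_def field_simps)
  have bound: "(\<integral>x. \<phi> x s \<partial>U01) \<le> 1" if s: "0 < s" "s \<le> 2 * r" for s
  proof -
    have "(\<integral>x. \<phi> x s \<partial>U01) \<le> (\<integral>x. C1 * s * \<phi> x 1 \<partial>U01)"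
    proof (rule integral_mono)
      show "integrable U01 (\<lambda>x. \<phi> x s)" "integrable U01 (\<lambda>x. C1 * s * \<phi> x 1)"
        using s by (auto intro!: MO_integrable MO)
      fix x assume "x \<in> space U01"
      then have x: "x \<in> {0..<1}" by simp
      have "\<phi> x (s * 1) \<le> C1 * s powr p * \<phi> x 1"
        using s r x by (intro lower) auto
      also have "\<dots> \<le> C1 * s powr 1 * \<phi> x 1"
        using s r q C MO_nonneg[OF MO x] by (intro mult_right_mono mult_left_mono powr_mono') auto
      finally show "\<phi> x s \<le> C1 * s * \<phi> x 1"
        using s by simp
    qed
    also have "\<dots> = C1 * s * I"
      by (simp add: I_def)
    also have "\<dots> \<le> C1 * (2 * r) * (I + 1)"
      using s I C by (intro mult_mono) auto
    also have "\<dots> = (C1 * (I + 1)) * (2 * r)"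
      by simp
    also have "\<dots> = 1 / 2"
      using M C I by (simp add: r_def)
    finally show ?thesis by simp
  qed
  show thesis
    using r by (intro that[of r] bound) auto
qed

text \<open>\<open>C3\<close> bounds the integral of a majorant of \<phi> at the transform, and
  dividing the transform by \<open>R > 1\<close> gains \<open>C1 / R\<close> because
  \<open>p > 1\<close>. That \<open>R\<close> precedes \<open>e\<close> and \<open>N\<close> yields
  one constant for all partial sums.\<close>

lemma transform_modular_bounded:
  "\<exists>R>0. \<forall>g e N. integrable U01 g \<longrightarrow> (\<forall>j. \<bar>e j\<bar> \<le> 1) \<longrightarrow> modular \<phi> g \<le> 1 \<longrightarrow>
    modular \<phi> (\<lambda>x. martingale_transform e (\<lambda>j k. dyadic_avg j k g) N (dyadic_index N x) / R) \<le> 1"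
proof -
  let ?D = "C2 * 2 powr p'"
  define c where "c = 2 powr - q / K"
  have D: "0 < ?D" using C by simp
  have "2 powr - q \<le> 1"
    using q powr_mono[of "- q" 0 2] by simp
  then have c01: "0 < c" "c \<le> 1"
    unfolding c_def using C by (auto simp: field_simps)
  obtain m0 where m0: "(1 - c) ^ m0 < 1 / (2 * ?D)"
    using real_arch_pow_inv[of "1 / (2 * ?D)" "1 - c"] D c01 by auto
  define m where "m = Suc m0"
  have "(1 - c) ^ m \<le> (1 - c) ^ m0"
    unfolding m_def using c01 by (intro power_decreasing) auto
  then have "?D * (1 - c) ^ m \<le> ?D * (1 - c) ^ m0"
    using D by (intro mult_left_mono) auto
  also have "\<dots> \<le> 1 / 2"
    using m0 D by (simp add: field_simps)
  finally have m: "0 < m" "?D * (1 - c) ^ m \<le> 1 / 2"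
    by (simp_all add: m_def)
  define \<gamma> where "\<gamma> = 1 / (10 * real m)"
  define B where "B = 2 * (?D / c) * (K * (C1 * C2 * (2 / \<gamma>) powr p' * (1 / (1 - 2 powr - (p - q)))))"
  have "2 powr - (p - q) < 1"
    using q powr_less_mono[of "- (p - q)" 0 2] by simp
  then have B: "0 \<le> B"
    unfolding B_def using C D c01 by (intro mult_nonneg_nonneg) auto
  define C3 where "C3 = 1 + ?D * (1 + B)"
  have C3: "1 \<le> C3" unfolding C3_def using D B by simp
  define R where "R = C1 * C3 + 1"
  have R: "1 < R" unfolding R_def using C C3 by (auto intro!: mult_pos_pos)
  obtain r where r: "0 < r" "(\<integral>x. \<phi> x r \<partial>U01) \<le> 1" "(\<integral>x. \<phi> x (2 * r) \<partial>U01) \<le> 1"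
    by (rule integral_small)
  show ?thesis
  proof (intro exI[of _ R] conjI allI impI)
    fix g :: "real \<Rightarrow> real" and e :: "nat \<Rightarrow> real" and N
    assume g: "integrable U01 g" and "\<forall>j. \<bar>e j\<bar> \<le> 1" and mod: "modular \<phi> g \<le> 1"
    then have e: "\<bar>e j\<bar> \<le> 1" for j by simp
    define T where "T = martingale_transform e (\<lambda>j k. dyadic_avg j k g)"
    let ?X = "\<lambda>s. exceedance (\<lambda>j k. \<bar>T j k\<bar>) N s"
    \<comment> \<open>The \<open>2 ^ N\<close> leaf values are bounded, so finitely many levels
      suffice; \<open>n\<close> depends on \<open>g\<close>, \<open>e\<close> and \<open>N\<close>,
      but the constants in the bounds below do not depend on \<open>n\<close>.\<close>
    obtain n where n: "\<And>l. l < 2 ^ N \<Longrightarrow> \<bar>T N l\<bar> \<le> r * 2 ^ Suc n"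
    proof -
      define b where "b = (\<Sum>l<2 ^ N. \<bar>T N l\<bar>)"
      obtain n where n: "b / r < 2 ^ n"
        using real_arch_pow[of 2 "b / r"] by auto
      have "\<bar>T N l\<bar> \<le> r * 2 ^ Suc n" if "l < 2 ^ N" for l
      proof -
        have "\<bar>T N l\<bar> \<le> b"
          unfolding b_def using that by (intro member_le_sum) auto
        also have "\<dots> \<le> r * 2 ^ n"
          using n r by (simp add: field_simps)
        also have "\<dots> \<le> r * 2 ^ Suc n"
          using r by simp
        finally show ?thesis .
      qed
      then show thesis by (rule that)
    qed
    \<comment> \<open>\<open>\<phi> x\<close> may jump, so \<open>\<phi> x \<bar>f x\<bar>\<close> need not be measurable in \<open>x\<close>; a measurable majorant is
      integrated instead.\<close>
    define F where
      "F i x = of_bool (dyadic_index N x \<in> ?X (r * 2 ^ Suc i)) * \<phi> x (r * 2 ^ Suc i)" for i x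
    define H where "H x = \<phi> x (2 * r) + ?D * (\<Sum>i<n. F i x)" for x
    have int: "integrable U01 (\<lambda>x. \<phi> x (2 * r))" "integrable U01 (\<lambda>x. \<phi> x (r * 2 ^ i))" for i
      using r by (auto intro!: MO_integrable MO)
    have Fint: "integrable U01 (F i)" for i
      unfolding F_def by (rule integrable_leaves[OF int(2)])
    then have Hint: "integrable U01 H"
      unfolding H_def using int(1) by auto
    have F: "(\<integral>x. F i x \<partial>U01) = sum (leaf_weight N (r * 2 ^ Suc i)) (?X (r * 2 ^ Suc i))" for i
      unfolding F_def by (rule integral_leaves[OF int(2)]) (auto simp: exceedance_def)
    have levels: "(\<Sum>i<n. sum (leaf_weight N (r * 2 ^ Suc i)) (?X (r * 2 ^ Suc i)))
        \<le> (\<integral>x. \<phi> x r \<partial>U01) + B"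
      unfolding T_def B_def
      by (rule sum_transform_levels_le[OF g _ mod c_def m r(1) \<gamma>_def]) (rule e)
    have "(\<integral>x. H x \<partial>U01) = (\<integral>x. \<phi> x (2 * r) \<partial>U01) + ?D * (\<Sum>i<n. \<integral>x. F i x \<partial>U01)"
      unfolding H_def using int(1) Fint
      by (simp add: Bochner_Integration.integral_add Bochner_Integration.integral_sum)
    also have "\<dots> = (\<integral>x. \<phi> x (2 * r) \<partial>U01)
        + ?D * (\<Sum>i<n. sum (leaf_weight N (r * 2 ^ Suc i)) (?X (r * 2 ^ Suc i)))"
      unfolding F ..
    also have "\<dots> \<le> 1 + ?D * (1 + B)"
      using levels r(2,3) D by (intro add_mono mult_left_mono) auto
    finally have HC3: "(\<integral>x. H x \<partial>U01) \<le> C3"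
      by (simp add: C3_def)
    have H: "\<phi> x \<bar>T N (dyadic_index N x)\<bar> \<le> H x" if x: "x \<in> {0..<1}" for x
    proof -
      let ?l = "dyadic_index N x"
      have l: "?l < 2 ^ N" by (rule dyadic_index_less[OF x])
      have "\<phi> x \<bar>T N ?l\<bar> \<le> \<phi> x (2 * r)
          + ?D * (\<Sum>i<n. of_bool (r * 2 ^ Suc i < \<bar>T N ?l\<bar>) * \<phi> x (r * 2 ^ Suc i))"
        using n[OF l] r by (intro le_sum_levels[OF x]) auto
      also have "\<dots> \<le> H x"
        unfolding H_def F_def
      proof (intro add_left_mono mult_left_mono sum_mono mult_right_mono)
        fix i
        \<comment> \<open>Depth \<open>N\<close> is among those inspected by
          \<open>exceedance\<close>, so the level set of the final value lies in that of the maximal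
          transform.\<close>
        show "(of_bool (r * 2 ^ Suc i < \<bar>T N ?l\<bar>) :: real) \<le> of_bool (?l \<in> ?X (r * 2 ^ Suc i))"
          using l by (force simp: exceedance_def of_bool_def intro: exI[of _ N])
        show "0 \<le> \<phi> x (r * 2 ^ Suc i)"
          using MO_nonneg[OF MO x] r by simp
      qed (use D in simp)
      finally show ?thesis .
    qed
    have "modular \<phi> (\<lambda>x. T N (dyadic_index N x) / R) \<le> (\<integral>\<^sup>+x. ennreal (C1 / R * H x) \<partial>U01)"
      unfolding modular_def
    proof (intro nn_integral_mono ennreal_leI)
      fix x assume "x \<in> space U01"
      then have x: "x \<in> {0..<1}" by simp
      let ?y = "\<bar>T N (dyadic_index N x)\<bar>"
      have "\<phi> x (1 / R * ?y) \<le> C1 * (1 / R) powr p * \<phi> x ?y"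
        using R x by (intro lower) auto
      also have "\<dots> \<le> C1 * (1 / R) powr 1 * \<phi> x ?y"
        using R q C MO_nonneg[OF MO x] by (intro mult_right_mono mult_left_mono powr_mono') auto
      also have "\<dots> = C1 / R * \<phi> x ?y"
        using R by simp
      also have "\<dots> \<le> C1 / R * H x"
        using H[OF x] R C by (intro mult_left_mono) auto
      finally show "\<phi> x \<bar>T N (dyadic_index N x) / R\<bar> \<le> C1 / R * H x"
        using R by simp
    qed
    also have "\<dots> = ennreal (\<integral>x. C1 / R * H x \<partial>U01)"
    proof (rule nn_integral_eq_integral)
      show "integrable U01 (\<lambda>x. C1 / R * H x)"
        using Hint by (intro integrable_mult_right) auto
      have "0 \<le> H x" if "x \<in> {0..<1}" for x
        using order_trans[OF MO_nonneg[OF MO that] H[OF that]] by simp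
      then show "AE x in U01. 0 \<le> C1 / R * H x"
        using R C by (intro AE_I2) auto
    qed
    also have "\<dots> = ennreal (C1 / R * (\<integral>x. H x \<partial>U01))"
      by simp
    also have "\<dots> \<le> ennreal (C1 / R * C3)"
      using HC3 R C by (intro ennreal_leI mult_left_mono) auto
    also have "\<dots> \<le> ennreal 1"
      using R by (intro ennreal_leI) (simp add: R_def)
    finally show "modular \<phi> (\<lambda>x. martingale_transform e (\<lambda>j k. dyadic_avg j k g) N (dyadic_index N x) / R) \<le> 1"
      by (simp add: T_def)
  qed (use R in simp)
qed

end

section \<open>From the modular to the norm\<close>

lemma modular_cong:
  "(\<And>x. x \<in> {0..<1} \<Longrightarrow> \<bar>f x\<bar> = \<bar>g x\<bar>) \<Longrightarrow> modular \<phi> f = modular \<phi> g"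
  unfolding modular_def by (intro nn_integral_cong) simp

lemma walsh_partial_sum_scale: "walsh_partial_sum n (\<lambda>x. f x / c) x = walsh_partial_sum n f x / c"
proof -
  have "walsh_coeff (\<lambda>x. f x / c) k = walsh_coeff f k / c" for k
    by (simp add: walsh_coeff_def)
  then show ?thesis
    by (simp add: walsh_partial_sum_def sum_divide_distrib)
qed

theorem theorem6p1:
  fixes \<phi> :: "real \<Rightarrow> real \<Rightarrow> real" and pminus pplus :: real
  assumes "MO_function \<phi>"
    and "A_infty \<phi>"
    and "uniformly_lower_type \<phi> pminus"
    and "uniformly_upper_type \<phi> pplus"
    and "q_index \<phi> < pminus" and "pminus \<le> pplus"
  shows "\<exists>C>0. \<forall>f. in_L_phi \<phi> f \<and> integrable U01 f \<longrightarrow>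
           (\<forall>n. in_L_phi \<phi> (walsh_partial_sum n f) \<and>
                L_phi_norm \<phi> (walsh_partial_sum n f) \<le> C * L_phi_norm \<phi> f)"
proof -
  have ne: "{q. q \<ge> 1 \<and> A_class q \<phi>} \<noteq> {}"
    using assms(2) by (auto simp: A_infty_def)
  \<comment> \<open>The infimum need not be attained, but as it lies below \<open>pminus\<close>, so
    does some admissible \<open>q\<close>.\<close>
  obtain q where q: "1 \<le> q" "A_class q \<phi>" "q < pminus"
    using cInf_lessD[OF ne assms(5)[unfolded q_index_def]] by auto
  obtain K where K: "weighted_avg_bound \<phi> q K"
    using A_class_one_weighted_avg A_class_gt_one_weighted_avg[OF assms(1) q(2)] q
    by (metis order_le_less)
  obtain C1 where C1: "\<And>x s t. x \<in> {0..<1} \<Longrightarrow> 0 < s \<Longrightarrow> s < 1 \<Longrightarrow> 0 \<le> t \<Longrightarrow>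
      \<phi> x (s * t) \<le> C1 * s powr pminus * \<phi> x t"
    using assms(3) unfolding uniformly_lower_type_def by blast
  obtain C2 where C2: "\<And>x s t. x \<in> {0..<1} \<Longrightarrow> 1 \<le> s \<Longrightarrow> 0 \<le> t \<Longrightarrow>
      \<phi> x (s * t) \<le> C2 * s powr pplus * \<phi> x t"
    using assms(4) unfolding uniformly_upper_type_def by blast
  interpret muckenhoupt_orlicz \<phi> pminus pplus q "max 1 C1" "max 1 C2" "max 1 K"
  proof
    note nonneg = MO_nonneg[OF assms(1)]
    fix x s t :: real assume x: "x \<in> {0..<1}" and t: "0 \<le> t"
    show "\<phi> x (s * t) \<le> max 1 C1 * s powr pminus * \<phi> x t" if "0 < s" "s < 1"
      by (rule order_trans[OF C1[OF x that t]]) (intro mult_right_mono nonneg[OF x t], auto)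
    show "\<phi> x (s * t) \<le> max 1 C2 * s powr pplus * \<phi> x t" if "1 \<le> s"
      by (rule order_trans[OF C2[OF x that t]]) (intro mult_right_mono nonneg[OF x t], auto)
  next
    show "weighted_avg_bound \<phi> q (max 1 K)"
      unfolding weighted_avg_bound_def
    proof (intro allI impI, elim conjE)
      fix n k :: nat and t :: real and h :: "real \<Rightarrow> real"
      assume *: "k < 2 ^ n" "0 < t" "integrable U01 h" "\<forall>x\<in>{0..<1}. 0 \<le> h x"
        "integrable U01 (\<lambda>x. h x powr q * \<phi> x t)"
      have "0 \<le> dyadic_integral n k (\<lambda>x. h x powr q * \<phi> x t)"
        using * MO_nonneg[OF assms(1)] by (intro dyadic_integral_nonneg) auto
      then have "K * dyadic_integral n k (\<lambda>x. h x powr q * \<phi> x t)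
          \<le> max 1 K * dyadic_integral n k (\<lambda>x. h x powr q * \<phi> x t)"
        by (intro mult_right_mono) auto
      moreover have "dyadic_integral n k (\<lambda>x. \<phi> x t) * dyadic_avg n k h powr q
            \<le> K * dyadic_integral n k (\<lambda>x. h x powr q * \<phi> x t)"
        using K * unfolding weighted_avg_bound_def by blast
      ultimately show "dyadic_integral n k (\<lambda>x. \<phi> x t) * dyadic_avg n k h powr q
            \<le> max 1 K * dyadic_integral n k (\<lambda>x. h x powr q * \<phi> x t)"
        by linarith
    qed
  qed (use assms q in auto)
  obtain R where R: "0 < R" and bounded: "\<And>g e N. \<lbrakk>integrable U01 g; \<forall>j. \<bar>e j\<bar> \<le> 1; modular \<phi> g \<le> 1\<rbrakk> \<Longrightarrow>
      modular \<phi> (\<lambda>x. martingale_transform e (\<lambda>j k. dyadic_avg j k g) N (dyadic_index N x) / R) \<le> 1"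
    using transform_modular_bounded by blast
  \<comment> \<open>Multiplying \<open>f / c\<close> and the transform by Walsh functions changes no
    modular, since these have modulus 1; the scale \<open>c\<close> is carried through by
    linearity.\<close>
  have step: "modular \<phi> (\<lambda>x. walsh_partial_sum n f x / (R * c)) \<le> 1"
    if f: "integrable U01 f" and c: "0 < c" "modular \<phi> (\<lambda>x. f x / c) \<le> 1" for f n c
  proof -
    let ?f = "\<lambda>x. f x / c"
    let ?g = "\<lambda>x. ?f x * walsh n x" and ?e = "\<lambda>j. of_bool (odd (n div 2 ^ j)) :: real"
    have fc: "integrable U01 ?f" using f by simp
    have "modular \<phi> ?g = modular \<phi> ?f"
      by (rule modular_cong) (simp add: abs_mult)
    then have "modular \<phi> (\<lambda>x. martingale_transform ?e (\<lambda>j k. dyadic_avg j k ?g) n (dyadic_index n x) / R) \<le> 1"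
      using c integrable_mult_walsh[OF fc] by (intro bounded) auto
    moreover have "modular \<phi> (\<lambda>x. walsh_partial_sum n f x / (R * c))
        = modular \<phi> (\<lambda>x. martingale_transform ?e (\<lambda>j k. dyadic_avg j k ?g) n (dyadic_index n x) / R)"
    proof (rule modular_cong)
      fix x :: real assume x: "x \<in> {0..<1}"
      have "walsh_partial_sum n f x / (R * c) = walsh_partial_sum n ?f x / R"
        by (simp add: walsh_partial_sum_scale)
      then show "\<bar>walsh_partial_sum n f x / (R * c)\<bar>
          = \<bar>martingale_transform ?e (\<lambda>j k. dyadic_avg j k ?g) n (dyadic_index n x) / R\<bar>"
        unfolding walsh_partial_sum_eq[OF fc x] by (simp add: abs_mult)
    qed
    ultimately show ?thesis by simp
  qed
  have "in_L_phi \<phi> (walsh_partial_sum n f) \<and>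
      L_phi_norm \<phi> (walsh_partial_sum n f) \<le> R * L_phi_norm \<phi> f"
    if f: "in_L_phi \<phi> f" "integrable U01 f" for f n
  proof
    let ?A = "{c. c > 0 \<and> modular \<phi> (\<lambda>x. f x / c) \<le> 1}"
    let ?B = "{c. c > 0 \<and> modular \<phi> (\<lambda>x. walsh_partial_sum n f x / c) \<le> 1}"
    have AB: "R * c \<in> ?B" if "c \<in> ?A" for c
      using that R step[OF f(2)] by simp
    obtain c0 where c0: "c0 \<in> ?A"
      using f(1) by (auto simp: in_L_phi_def)
    have "walsh_partial_sum n f \<in> borel_measurable U01"
      unfolding walsh_partial_sum_def by (rule borel_measurable_U01) measurable
    then show "in_L_phi \<phi> (walsh_partial_sum n f)"
      using AB[OF c0] by (auto simp: in_L_phi_def)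
    have bdd: "bdd_below ?B"
      by (rule bdd_belowI[of _ 0]) auto
    \<comment> \<open>Comparing the two sets of admissible scales avoids asking whether the infima
      are attained.\<close>
    have "Inf ?B / R \<le> Inf ?A"
    proof (rule cInf_greatest)
      fix c assume "c \<in> ?A"
      then have "Inf ?B \<le> R * c"
        using AB bdd by (intro cInf_lower) auto
      then show "Inf ?B / R \<le> c"
        using R by (simp add: field_simps)
    qed (use c0 in blast)
    then show "L_phi_norm \<phi> (walsh_partial_sum n f) \<le> R * L_phi_norm \<phi> f"
      unfolding L_phi_norm_def using R by (simp add: field_simps)
  qed
  then show ?thesis
    using R by blast
qed

end
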